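(* Let $\mathcal{MV}^{\mathrm{lcc}}$ be the category of limit cut complete MV-algebras with MV-algebra homomorphisms, and let ${}^{\mathrm{MV}}\mathcal{S}tone$ be the category of Stone MV-spaces with continuous maps. Then the functors $\mathrm{Clop}$ and $\mathrm{Max}$ defined below, restricted to these two categories, form a duality (dual equivalence) between $\mathcal{MV}^{\mathrm{lcc}}$ and ${}^{\mathrm{MV}}\mathcal{S}tone$. In particular, $\mathrm{Clop}\,\mathrm{Max}\,A\cong A$ for every limit cut complete MV-algebra $A$, and $\mathrm{Max}\,\mathrm{Clop}\,\tau$ is MV-homeomorphic to $\tau$ for every Stone MV-space $\tau$.
   Context: For a set $X$, $[0,1]^X$ is the MV-algebra of all functions $X\to[0,1]$ (fuzzy subsets of $X$) with pointwise operations $x\oplus y=\min(1,x+y)$, $x^*=1-x$, $x\odot y=\max(0,x+y-1)$, and pointwise order, joins $\vee$ and meets $\wedge$; $\mathbf 0,\mathbf 1$ are the constant functions. Crisp subsets are identified with their characteristic functions. An MV-topology on $X$ is a set $\Omega\subseteq[0,1]^X$ containing $\mathbf 0,\mathbf 1$, closed under arbitrary (pointwise) joins and under binary $\oplus$, $\odot$, $\wedge$; $\langle X,\Omega\rangle$ is an MV-topological space, elements of $\Omega$ are open, elements $o^*$ with $o\in\Omega$ are closed, and clopen means both. A map $f:X\to Y$ between MV-topological spaces $\langle X,\Omega_X\rangle,\langle Y,\Omega_Y\rangle$ is continuous if $\alpha\circ f\in\Omega_X$ for all $\alpha\in\Omega_Y$; an MV-homeomorphism is a bijection with $f$ and $f^{-1}$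 continuous. A covering of $X$ is $\Gamma\subseteq[0,1]^X$ with $\bigvee\Gamma=\mathbf 1$. The space is compact if every covering by open sets contains an additive covering, i.e. finitely many members $\alpha_1,\dots,\alpha_n$ (repetitions allowed) with $\alpha_1\oplus\cdots\oplus\alpha_n=\mathbf 1$; it is Hausdorff if for all $x\neq y$ in $X$ there are $o_x,o_y\in\Omega$ with $o_x(x)=o_y(y)=1$ and $o_x\wedge o_y=\mathbf 0$; it is zero-dimensional if it has a base of clopen sets (a base is $\Theta\subseteq\Omega$ such that every open set is a join of elements of $\Theta$). A Stone MV-space is a compact, Hausdorff, zero-dimensional MV-topological space. For an MV-algebra $A$, $\mathrm{Max}A$ is its set of maximal ideals. For each $M\in\mathrm{Max}A$, $A/M$ embeds uniquely into $[0,1]$ via $\iota_M$; for $a\in A$ let $\widehat a:\mathrm{Max}A\to[0,1]$, $\widehat a(M)=\iota_M(a/M)$, and $\widehat A=\{\widehat a: a\in A\}$. The map $\iota:a\mapsto\widehat a$ is an MV-homomorphism $A\to[0,1]^{\mathrm{Max}A}$; $A$ is semisimple iff $\iota$ is injective (the intersection of all maximal ideals is $\{0\}$). $\Omega_A$ is the MV-topology on $\mathrm{Max}A$ consisting of all joins of subsets of $\widehat A$. The functor $\mathrm{Max}$ sends $A$ to $\langle\mathrm{Max}A,\Omega_A\rangle$ and a homomorphism $h:A\to B$ to the map $N\mapsto h^{-1}[N]$ from $\mathrm{Max}B$ to $\mathrm{Max}A$. The functor $\mathrm{Clop}$ sends an MV-topological space $\tau$ to the MV-algebra $\mathrm{Clop}\,\tau$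 of its clopen fuzzy subsets (a subalgebra of $[0,1]^X$) and a continuous $f:\tau\to\tau'$ to the homomorphism $\alpha\mapsto\alpha\circ f$ from $\mathrm{Clop}\,\tau'$ to $\mathrm{Clop}\,\tau$. For a semisimple MV-algebra $A$ and $Z\subseteq A$, $uZ$ and $lZ$ denote the sets of upper and lower bounds of $Z$ in $A$; $Z$ is a cut if $Z=luZ$. A cut $Z$ is a limit cut if $\bigwedge\{\widehat b\odot(\widehat a)^*: b\in uZ,\ a\in Z\}=\mathbf 0$ in $[0,1]^{\mathrm{Max}A}$. $A$ is limit cut complete (lcc) if every limit cut of $A$ has a supremum in $A$, equivalently, the supremum of $\widehat Z$ in $[0,1]^{\mathrm{Max}A}$ belongs to $\widehat A$ for every limit cut $Z$. *)

theory Defs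
  imports Complex_Main "HOL-Library.FuncSet" "HOL-Algebra.Order"
begin

text \<open>
  Conventions. Structures are carrier-based records. All morphisms, and all fuzzy subsets of a
  set, are extensional functions (arbitrary outside their domain), so that equality of morphisms
  is plain equality, identities are \<open>\<lambda>x\<in>X. x\<close> and composition is \<^const>\<open>compose\<close>.
\<close>

section \<open>MV-algebras\<close>

record 'a mv_algebra = "'a partial_object" +
  mv_plus :: "'a \<Rightarrow> 'a \<Rightarrow> 'a" (infixl \<open>\<oplus>\<index>\<close> 65)
  mv_neg :: "'a \<Rightarrow> 'a" (\<open>\<sim>\<index> _\<close> [81] 80)
  mv_zero :: 'a (\<open>\<zero>\<index>\<close>)

locale mv_algebra =
  fixes A :: "'a mv_algebra" (structure)
  assumes plus_closed: "\<lbrakk>x \<in> carrier A; y \<in> carrier A\<rbrakk> \<Longrightarrow> x \<oplus> y \<in> carrier A"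
    and neg_closed: "x \<in> carrier A \<Longrightarrow> \<sim> x \<in> carrier A"
    and zero_closed: "\<zero> \<in> carrier A"
    and plus_assoc: "\<lbrakk>x \<in> carrier A; y \<in> carrier A; z \<in> carrier A\<rbrakk>
      \<Longrightarrow> (x \<oplus> y) \<oplus> z = x \<oplus> (y \<oplus> z)"
    and plus_comm: "\<lbrakk>x \<in> carrier A; y \<in> carrier A\<rbrakk> \<Longrightarrow> x \<oplus> y = y \<oplus> x"
    and plus_zero: "x \<in> carrier A \<Longrightarrow> x \<oplus> \<zero> = x"
    and neg_neg: "x \<in> carrier A \<Longrightarrow> \<sim> (\<sim> x) = x"
    and plus_neg_zero: "x \<in> carrier A \<Longrightarrow> x \<oplus> \<sim> \<zero> = \<sim> \<zero>"
    and lukasiewicz: "\<lbrakk>x \<in> carrier A; y \<in> carrier A\<rbrakk>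
      \<Longrightarrow> \<sim> (\<sim> x \<oplus> y) \<oplus> y = \<sim> (\<sim> y \<oplus> x) \<oplus> x"

definition mv_one :: "'a mv_algebra \<Rightarrow> 'a" (\<open>\<one>\<index>\<close>) where
  "mv_one A = \<sim>\<^bsub>A\<^esub> \<zero>\<^bsub>A\<^esub>"

definition mv_times :: "'a mv_algebra \<Rightarrow> 'a \<Rightarrow> 'a \<Rightarrow> 'a" (infixl \<open>\<odot>\<index>\<close> 70) where
  "mv_times A x y = \<sim>\<^bsub>A\<^esub> (\<sim>\<^bsub>A\<^esub> x \<oplus>\<^bsub>A\<^esub> \<sim>\<^bsub>A\<^esub> y)"

definition mv_le :: "'a mv_algebra \<Rightarrow> 'a \<Rightarrow> 'a \<Rightarrow> bool" where
  "mv_le A x y \<longleftrightarrow> \<sim>\<^bsub>A\<^esub> x \<oplus>\<^bsub>A\<^esub> y = \<one>\<^bsub>A\<^esub>"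

definition mv_order :: "'a mv_algebra \<Rightarrow> 'a gorder" where
  "mv_order A = \<lparr>carrier = carrier A, eq = (=), le = mv_le A\<rparr>"

definition mv_hom :: "'a mv_algebra \<Rightarrow> 'b mv_algebra \<Rightarrow> ('a \<Rightarrow> 'b) set" where
  "mv_hom A B = {h \<in> carrier A \<rightarrow>\<^sub>E carrier B.
     (\<forall>x\<in>carrier A. \<forall>y\<in>carrier A. h (x \<oplus>\<^bsub>A\<^esub> y) = h x \<oplus>\<^bsub>B\<^esub> h y) \<and>
     (\<forall>x\<in>carrier A. h (\<sim>\<^bsub>A\<^esub> x) = \<sim>\<^bsub>B\<^esub> h x) \<and>
     h \<zero>\<^bsub>A\<^esub> = \<zero>\<^bsub>B\<^esub>}"

definition mv_iso :: "'a mv_algebra \<Rightarrow> 'b mv_algebra \<Rightarrow> ('a \<Rightarrow> 'b) set" where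
  "mv_iso A B = {h \<in> mv_hom A B. bij_betw h (carrier A) (carrier B)}"

definition mv_ideal :: "'a mv_algebra \<Rightarrow> 'a set \<Rightarrow> bool" where
  "mv_ideal A I \<longleftrightarrow> I \<subseteq> carrier A \<and> \<zero>\<^bsub>A\<^esub> \<in> I \<and>
     (\<forall>x\<in>I. \<forall>y\<in>I. x \<oplus>\<^bsub>A\<^esub> y \<in> I) \<and>
     (\<forall>x\<in>carrier A. \<forall>y\<in>I. mv_le A x y \<longrightarrow> x \<in> I)"

definition max_ideals :: "'a mv_algebra \<Rightarrow> 'a set set" where
  "max_ideals A = {M. mv_ideal A M \<and> M \<noteq> carrier A \<and>
     (\<forall>I. mv_ideal A I \<and> M \<subseteq> I \<longrightarrow> I = M \<or> I = carrier A)}"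

text \<open>The intersection is relativised to the carrier because a one-element algebra has no maximal
  ideals; such an algebra counts as semisimple.\<close>

definition semisimple :: "'a mv_algebra \<Rightarrow> bool" where
  "semisimple A \<longleftrightarrow> mv_algebra A \<and> carrier A \<inter> \<Inter> (max_ideals A) = {\<zero>\<^bsub>A\<^esub>}"

section \<open>The algebras $[0,1]$ and $[0,1]^X$\<close>

definition unit_interval :: "real mv_algebra" where
  "unit_interval = \<lparr>carrier = {0..1}, mv_plus = (\<lambda>x y. min 1 (x + y)),
     mv_neg = (\<lambda>x. 1 - x), mv_zero = 0\<rparr>"

definition fuzzy :: "'x set \<Rightarrow> ('x \<Rightarrow> real) mv_algebra" where
  "fuzzy X = \<lparr>carrier = X \<rightarrow>\<^sub>E {0..1}, mv_plus = (\<lambda>\<alpha> \<beta>. \<lambda>x\<in>X. min 1 (\<alpha> x + \<beta> x)),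
     mv_neg = (\<lambda>\<alpha>. \<lambda>x\<in>X. 1 - \<alpha> x), mv_zero = (\<lambda>x\<in>X. 0)\<rparr>"

text \<open>Inserting the bottom (top) element of $[0,1]$ makes the empty join (meet) correct and does not
  affect the others.\<close>

definition fuzzy_Join :: "'x set \<Rightarrow> ('x \<Rightarrow> real) set \<Rightarrow> 'x \<Rightarrow> real" where
  "fuzzy_Join X \<Gamma> = (\<lambda>x\<in>X. Sup (insert 0 ((\<lambda>\<alpha>. \<alpha> x) ` \<Gamma>)))"

definition fuzzy_Meet :: "'x set \<Rightarrow> ('x \<Rightarrow> real) set \<Rightarrow> 'x \<Rightarrow> real" where
  "fuzzy_Meet X \<Gamma> = (\<lambda>x\<in>X. Inf (insert 1 ((\<lambda>\<alpha>. \<alpha> x) ` \<Gamma>)))"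

definition fuzzy_min :: "'x set \<Rightarrow> ('x \<Rightarrow> real) \<Rightarrow> ('x \<Rightarrow> real) \<Rightarrow> 'x \<Rightarrow> real" where
  "fuzzy_min X \<alpha> \<beta> = (\<lambda>x\<in>X. min (\<alpha> x) (\<beta> x))"

lemma fuzzy_one: "\<one>\<^bsub>fuzzy X\<^esub> = (\<lambda>x\<in>X. 1)"
  by (auto simp: mv_one_def fuzzy_def restrict_def)

lemma fuzzy_times: "\<alpha> \<odot>\<^bsub>fuzzy X\<^esub> \<beta> = (\<lambda>x\<in>X. max 0 (\<alpha> x + \<beta> x - 1))"
  by (auto simp: mv_times_def fuzzy_def restrict_def fun_eq_iff min_def max_def)

lemma fuzzy_le:
  assumes "\<alpha> \<in> carrier (fuzzy X)" "\<beta> \<in> carrier (fuzzy X)"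
  shows "mv_le (fuzzy X) \<alpha> \<beta> \<longleftrightarrow> (\<forall>x\<in>X. \<alpha> x \<le> \<beta> x)"
proof -
  have "mv_le (fuzzy X) \<alpha> \<beta> \<longleftrightarrow> (\<forall>x\<in>X. min 1 (1 - \<alpha> x + \<beta> x) = 1)"
    by (auto simp: mv_le_def fuzzy_one fun_eq_iff) (auto simp: fuzzy_def fun_eq_iff split: if_splits)
  then show ?thesis by (auto simp: min_def split: if_splits)
qed

section \<open>The representation by functions on the maximal ideals\<close>

definition mv_dist :: "'a mv_algebra \<Rightarrow> 'a \<Rightarrow> 'a \<Rightarrow> 'a" where
  "mv_dist A x y = (x \<odot>\<^bsub>A\<^esub> \<sim>\<^bsub>A\<^esub> y) \<oplus>\<^bsub>A\<^esub> (y \<odot>\<^bsub>A\<^esub> \<sim>\<^bsub>A\<^esub> x)"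

definition mv_cong :: "'a mv_algebra \<Rightarrow> 'a set \<Rightarrow> 'a rel" where
  "mv_cong A I = {(x, y). x \<in> carrier A \<and> y \<in> carrier A \<and> mv_dist A x y \<in> I}"

definition mv_quot :: "'a mv_algebra \<Rightarrow> 'a set \<Rightarrow> 'a set mv_algebra" where
  "mv_quot A I = \<lparr>carrier = carrier A // mv_cong A I,
     mv_plus = (\<lambda>U V. \<Union>x\<in>U. \<Union>y\<in>V. mv_cong A I `` {x \<oplus>\<^bsub>A\<^esub> y}),
     mv_neg = (\<lambda>U. \<Union>x\<in>U. mv_cong A I `` {\<sim>\<^bsub>A\<^esub> x}),
     mv_zero = mv_cong A I `` {\<zero>\<^bsub>A\<^esub>}\<rparr>"

text \<open>For a maximal ideal there is exactly one embedding of the quotient into $[0,1]$.\<close>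

definition mv_emb :: "'a mv_algebra \<Rightarrow> 'a set \<Rightarrow> 'a set \<Rightarrow> real" where
  "mv_emb A M = (THE h. h \<in> mv_hom (mv_quot A M) unit_interval \<and> inj_on h (carrier (mv_quot A M)))"

definition hat :: "'a mv_algebra \<Rightarrow> 'a \<Rightarrow> 'a set \<Rightarrow> real" where
  "hat A a = (\<lambda>M\<in>max_ideals A. mv_emb A M (mv_cong A M `` {a}))"

section \<open>Limit cut complete MV-algebras\<close>

definition cut :: "'a mv_algebra \<Rightarrow> 'a set \<Rightarrow> bool" where
  "cut A Z \<longleftrightarrow> Z \<subseteq> carrier A \<and> Z = Lower (mv_order A) (Upper (mv_order A) Z)"

definition limit_cut :: "'a mv_algebra \<Rightarrow> 'a set \<Rightarrow> bool" where
  "limit_cut A Z \<longleftrightarrow> cut A Z \<and>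
     (let F = fuzzy (max_ideals A) in
      fuzzy_Meet (max_ideals A) {hat A b \<odot>\<^bsub>F\<^esub> \<sim>\<^bsub>F\<^esub> hat A a | a b. b \<in> Upper (mv_order A) Z \<and> a \<in> Z}
        = \<zero>\<^bsub>F\<^esub>)"

definition lcc :: "'a mv_algebra \<Rightarrow> bool" where
  "lcc A \<longleftrightarrow> semisimple A \<and>
     (\<forall>Z. limit_cut A Z \<longrightarrow> (\<exists>s. least (mv_order A) s (Upper (mv_order A) Z)))"

section \<open>MV-topological spaces\<close>

record 'x mv_space = "'x partial_object" +
  opens :: "('x \<Rightarrow> real) set"

definition mv_topological_space :: "'x mv_space \<Rightarrow> bool" where
  "mv_topological_space T \<longleftrightarrow> (let X = carrier T; F = fuzzy X; \<Omega> = opens T in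
     \<Omega> \<subseteq> carrier F \<and> \<zero>\<^bsub>F\<^esub> \<in> \<Omega> \<and> \<one>\<^bsub>F\<^esub> \<in> \<Omega> \<and>
     (\<forall>\<Gamma>. \<Gamma> \<subseteq> \<Omega> \<longrightarrow> fuzzy_Join X \<Gamma> \<in> \<Omega>) \<and>
     (\<forall>\<alpha>\<in>\<Omega>. \<forall>\<beta>\<in>\<Omega>. \<alpha> \<oplus>\<^bsub>F\<^esub> \<beta> \<in> \<Omega> \<and> \<alpha> \<odot>\<^bsub>F\<^esub> \<beta> \<in> \<Omega> \<and> fuzzy_min X \<alpha> \<beta> \<in> \<Omega>))"

definition closeds :: "'x mv_space \<Rightarrow> ('x \<Rightarrow> real) set" where
  "closeds T = {\<sim>\<^bsub>fuzzy (carrier T)\<^esub> \<alpha> | \<alpha>. \<alpha> \<in> opens T}"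

definition clopens :: "'x mv_space \<Rightarrow> ('x \<Rightarrow> real) set" where
  "clopens T = opens T \<inter> closeds T"

definition mv_continuous :: "'x mv_space \<Rightarrow> 'y mv_space \<Rightarrow> ('x \<Rightarrow> 'y) set" where
  "mv_continuous S T = {f \<in> carrier S \<rightarrow>\<^sub>E carrier T.
     \<forall>\<alpha>\<in>opens T. compose (carrier S) \<alpha> f \<in> opens S}"

definition mv_homeo :: "'x mv_space \<Rightarrow> 'y mv_space \<Rightarrow> ('x \<Rightarrow> 'y) set" where
  "mv_homeo S T = {f \<in> mv_continuous S T. bij_betw f (carrier S) (carrier T) \<and>
     restrict (inv_into (carrier S) f) (carrier T) \<in> mv_continuous T S}"

text \<open>The list of members of an additive covering may be empty. This matters only for the empty
  space, which is therefore compact; it corresponds to the one-element MV-algebra.\<close>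

definition mv_compact :: "'x mv_space \<Rightarrow> bool" where
  "mv_compact T \<longleftrightarrow> (let F = fuzzy (carrier T) in
     \<forall>\<Gamma>. \<Gamma> \<subseteq> opens T \<and> fuzzy_Join (carrier T) \<Gamma> = \<one>\<^bsub>F\<^esub> \<longrightarrow>
       (\<exists>\<alpha>s. set \<alpha>s \<subseteq> \<Gamma> \<and> foldr (mv_plus F) \<alpha>s \<zero>\<^bsub>F\<^esub> = \<one>\<^bsub>F\<^esub>))"

definition mv_Hausdorff :: "'x mv_space \<Rightarrow> bool" where
  "mv_Hausdorff T \<longleftrightarrow> (\<forall>x\<in>carrier T. \<forall>y\<in>carrier T. x \<noteq> y \<longrightarrow>
     (\<exists>\<alpha>\<in>opens T. \<exists>\<beta>\<in>opens T. \<alpha> x = 1 \<and> \<beta> y = 1 \<and>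
        fuzzy_min (carrier T) \<alpha> \<beta> = \<zero>\<^bsub>fuzzy (carrier T)\<^esub>))"

definition mv_base :: "'x mv_space \<Rightarrow> ('x \<Rightarrow> real) set \<Rightarrow> bool" where
  "mv_base T \<Theta> \<longleftrightarrow> \<Theta> \<subseteq> opens T \<and> (\<forall>\<alpha>\<in>opens T. \<exists>\<Gamma>\<subseteq>\<Theta>. \<alpha> = fuzzy_Join (carrier T) \<Gamma>)"

definition mv_zero_dimensional :: "'x mv_space \<Rightarrow> bool" where
  "mv_zero_dimensional T \<longleftrightarrow> (\<exists>\<Theta>\<subseteq>clopens T. mv_base T \<Theta>)"

definition stone_mv_space :: "'x mv_space \<Rightarrow> bool" where
  "stone_mv_space T \<longleftrightarrow>
     mv_topological_space T \<and> mv_compact T \<and> mv_Hausdorff T \<and> mv_zero_dimensional T"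

section \<open>The functors and the two natural transformations\<close>

definition Max_space :: "'a mv_algebra \<Rightarrow> 'a set mv_space" where
  "Max_space A = \<lparr>carrier = max_ideals A,
     opens = {fuzzy_Join (max_ideals A) \<Gamma> | \<Gamma>. \<Gamma> \<subseteq> hat A ` carrier A}\<rparr>"

definition Max_map :: "'a mv_algebra \<Rightarrow> 'b mv_algebra \<Rightarrow> ('a \<Rightarrow> 'b) \<Rightarrow> 'b set \<Rightarrow> 'a set" where
  "Max_map A B h = (\<lambda>N\<in>max_ideals B. {a \<in> carrier A. h a \<in> N})"

definition Clop_algebra :: "'x mv_space \<Rightarrow> ('x \<Rightarrow> real) mv_algebra" where
  "Clop_algebra T = (fuzzy (carrier T))\<lparr>carrier := clopens T\<rparr>"

definition Clop_map ::
    "'x mv_space \<Rightarrow> 'y mv_space \<Rightarrow> ('x \<Rightarrow> 'y) \<Rightarrow> ('y \<Rightarrow> real) \<Rightarrow> 'x \<Rightarrow> real" where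
  "Clop_map S T f = (\<lambda>\<alpha>\<in>clopens T. compose (carrier S) \<alpha> f)"

definition hat_map :: "'a mv_algebra \<Rightarrow> 'a \<Rightarrow> 'a set \<Rightarrow> real" where
  "hat_map A = (\<lambda>a\<in>carrier A. hat A a)"

definition point_map :: "'x mv_space \<Rightarrow> 'x \<Rightarrow> ('x \<Rightarrow> real) set" where
  "point_map T = (\<lambda>x\<in>carrier T. {\<alpha> \<in> clopens T. \<alpha> x = 0})"

end

theory Submission
  imports Defs
begin

text \<open>
  Everything rests on the bijection between the maximal ideals of an MV-algebra and its
  homomorphisms to $[0,1]$: such a homomorphism is determined by its kernel, because two of them
  with the same kernel have their distance doubled by $x \mapsto x \oplus x$ or
  $x \mapsto x \odot x$, and every maximal ideal is a kernel, because the quotient is a simple chain.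
  Compactness of the space of maximal ideals is then the existence of a maximal ideal containing a
  given proper one, while compactness of a Stone MV-space makes every maximal ideal of its clopen
  algebra the kernel of an evaluation. A fuzzy subset is the supremum of a limit cut exactly when it
  is both a pointwise supremum and a pointwise infimum of elements of the algebra, that is, when it
  is clopen, so completeness for limit cuts says that the algebra has all clopens.
\<close>

section \<open>Arithmetic in MV-algebras\<close>

text \<open>The step with real content is that a simple chain embeds in [0,1]. The usual route
  builds an ordered group around the chain and applies Hoelder's theorem; reading off binary digits
  instead stays inside the chain and needs only \<oplus>, \<odot> and comparison of an element with
  its negation. The obstacle is that \<oplus> truncates at \<one>: identities of real arithmetic
  survive only for sums known not to overflow, so much of the arithmetic is about the condition
  \<open>x \<preceq> \<sim> y\<close>, which says exactly that x + y does not overflow. Since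
  \<open>mv_emb\<close> is defined by a description operator, nothing can be said about
  \<open>hat\<close> before both existence and uniqueness of the embedding are settled. On the
  topological side, the opens of both kinds of space are treated uniformly as joins of an algebra of
  fuzzy sets, which reduces openness to approximation from below and continuity to a check on that
  algebra.\<close>

context mv_algebra
begin

abbreviation le (infix \<open>\<preceq>\<close> 50) where "x \<preceq> y \<equiv> mv_le A x y"
text \<open>Truncated subtraction x \<odot> \<sim> y. In this form the Lukasiewicz axiom reads
  \<open>(x \<ominus> y) \<oplus> y = (y \<ominus> x) \<oplus> x\<close>: both sides are the join of
  x and y.\<close>

definition diff (infixl \<open>\<ominus>\<close> 65) where "x \<ominus> y = \<sim> (\<sim> x \<oplus> y)"

declare plus_closed [simp, intro] neg_closed [simp, intro] zero_closed [simp, intro]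
  plus_zero [simp] neg_neg [simp]

lemma diff_closed [simp, intro]: "x \<in> carrier A \<Longrightarrow> y \<in> carrier A \<Longrightarrow> x \<ominus> y \<in> carrier A"
  by (simp add: diff_def)

lemma one_closed [simp, intro]: "\<one> \<in> carrier A"
  by (simp add: mv_one_def)

lemma times_closed [simp, intro]: "x \<in> carrier A \<Longrightarrow> y \<in> carrier A \<Longrightarrow> x \<odot> y \<in> carrier A"
  by (simp add: mv_times_def)

lemma neg_zero [simp]: "\<sim> \<zero> = \<one>"
  by (simp add: mv_one_def)

lemma neg_one [simp]: "\<sim> \<one> = \<zero>"
  using neg_neg[OF zero_closed] by (simp only: neg_zero)

lemma plus_one [simp]: "x \<in> carrier A \<Longrightarrow> x \<oplus> \<one> = \<one>"
  using plus_neg_zero by simp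

lemma zero_plus [simp]: "x \<in> carrier A \<Longrightarrow> \<zero> \<oplus> x = x"
  using plus_comm[of \<zero> x] by simp

lemma one_plus [simp]: "x \<in> carrier A \<Longrightarrow> \<one> \<oplus> x = \<one>"
  using plus_comm[of \<one> x] by simp

lemma plus_left_comm:
  "x \<in> carrier A \<Longrightarrow> y \<in> carrier A \<Longrightarrow> z \<in> carrier A \<Longrightarrow> x \<oplus> (y \<oplus> z) = y \<oplus> (x \<oplus> z)"
  by (metis plus_assoc plus_comm)

lemmas plus_ac = plus_assoc plus_comm plus_left_comm

lemma neg_plus_self [simp]: "x \<in> carrier A \<Longrightarrow> \<sim> x \<oplus> x = \<one>"
  using lukasiewicz[of x \<one>] by simp

lemma plus_neg_self [simp]: "x \<in> carrier A \<Longrightarrow> x \<oplus> \<sim> x = \<one>"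
  using plus_comm[of x "\<sim> x"] by simp

lemma le_refl [simp]: "x \<in> carrier A \<Longrightarrow> x \<preceq> x"
  by (simp add: mv_le_def)

lemma le_antisym:
  "x \<preceq> y \<Longrightarrow> y \<preceq> x \<Longrightarrow> x \<in> carrier A \<Longrightarrow> y \<in> carrier A \<Longrightarrow> x = y"
  using lukasiewicz[of x y] unfolding mv_le_def by simp

lemma diff_plus:
  "x \<preceq> y \<Longrightarrow> x \<in> carrier A \<Longrightarrow> y \<in> carrier A \<Longrightarrow> (y \<ominus> x) \<oplus> x = y"
  using lukasiewicz[of x y] unfolding mv_le_def diff_def by simp

lemma le_plus1 [simp]: "x \<in> carrier A \<Longrightarrow> y \<in> carrier A \<Longrightarrow> x \<preceq> x \<oplus> y"
  by (simp add: mv_le_def plus_assoc[symmetric])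

lemma le_plus2 [simp]: "x \<in> carrier A \<Longrightarrow> y \<in> carrier A \<Longrightarrow> x \<preceq> y \<oplus> x"
  by (simp add: plus_comm[of y])

text \<open>The order is the algebraic one, with y \<ominus> x as the missing summand; transitivity
  and monotonicity then become associativity of \<oplus>.\<close>

lemma le_obtain:
  assumes "x \<preceq> y" "x \<in> carrier A" "y \<in> carrier A"
  obtains w where "w \<in> carrier A" "y = x \<oplus> w"
proof
  show "y = x \<oplus> (y \<ominus> x)" using assms diff_plus plus_comm by simp
qed (use assms in simp)

lemma le_trans [trans]:
  assumes "x \<preceq> y" "y \<preceq> z" "x \<in> carrier A" "y \<in> carrier A" "z \<in> carrier A"
  shows "x \<preceq> z"
proof -
  obtain v where v: "v \<in> carrier A" "y = x \<oplus> v" using le_obtain assms by blast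
  obtain w where "w \<in> carrier A" "z = y \<oplus> w" using le_obtain assms by blast
  then show ?thesis using v assms by (simp add: plus_assoc)
qed

lemma plus_mono:
  assumes "x \<preceq> y" "x' \<preceq> y'" "x \<in> carrier A" "y \<in> carrier A" "x' \<in> carrier A" "y' \<in> carrier A"
  shows "x \<oplus> x' \<preceq> y \<oplus> y'"
proof -
  obtain v where v: "v \<in> carrier A" "y = x \<oplus> v" using le_obtain assms by blast
  obtain w where w: "w \<in> carrier A" "y' = x' \<oplus> w" using le_obtain assms by blast
  have "y \<oplus> y' = (x \<oplus> x') \<oplus> (v \<oplus> w)" using v w assms by (simp add: plus_ac)
  then show ?thesis using assms v w by simp
qed

lemma neg_le_neg [simp]: "x \<in> carrier A \<Longrightarrow> y \<in> carrier A \<Longrightarrow> \<sim> x \<preceq> \<sim> y \<longleftrightarrow> y \<preceq> x"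
  by (simp add: mv_le_def plus_comm)

lemma le_neg_sym: "x \<in> carrier A \<Longrightarrow> y \<in> carrier A \<Longrightarrow> x \<preceq> \<sim> y \<longleftrightarrow> y \<preceq> \<sim> x"
  by (simp add: mv_le_def plus_comm)

lemma zero_le [simp]: "x \<in> carrier A \<Longrightarrow> \<zero> \<preceq> x"
  by (simp add: mv_le_def)

lemma le_one [simp]: "x \<in> carrier A \<Longrightarrow> x \<preceq> \<one>"
  by (simp add: mv_le_def)

lemma le_zero_iff: "x \<in> carrier A \<Longrightarrow> x \<preceq> \<zero> \<longleftrightarrow> x = \<zero>"
  by (metis le_antisym zero_le zero_closed le_refl)

lemma one_le_iff: "x \<in> carrier A \<Longrightarrow> \<one> \<preceq> x \<longleftrightarrow> x = \<one>"
  by (metis le_antisym le_one one_closed le_refl)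

text \<open>Residuation: subtracting y is adjoint to adding y. Unfolded, both sides are the same
  equation up to associativity.\<close>

lemma diff_le_iff:
  "x \<in> carrier A \<Longrightarrow> y \<in> carrier A \<Longrightarrow> z \<in> carrier A \<Longrightarrow> x \<ominus> y \<preceq> z \<longleftrightarrow> x \<preceq> y \<oplus> z"
  by (simp add: diff_def mv_le_def plus_assoc)

lemma diff_le [simp]: "x \<in> carrier A \<Longrightarrow> y \<in> carrier A \<Longrightarrow> x \<ominus> y \<preceq> x"
  by (simp add: diff_le_iff)

lemma le_diff_plus: "x \<in> carrier A \<Longrightarrow> y \<in> carrier A \<Longrightarrow> x \<preceq> y \<oplus> (x \<ominus> y)"
  by (simp add: diff_le_iff[symmetric])

lemma diff_eq_zero_iff: "x \<in> carrier A \<Longrightarrow> y \<in> carrier A \<Longrightarrow> x \<ominus> y = \<zero> \<longleftrightarrow> x \<preceq> y"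
  by (metis diff_le_iff le_zero_iff plus_zero diff_closed zero_closed)

lemma diff_le_neg [simp]: "x \<in> carrier A \<Longrightarrow> y \<in> carrier A \<Longrightarrow> x \<ominus> y \<preceq> \<sim> y"
  by (simp add: diff_def)

lemma times_neg: "x \<in> carrier A \<Longrightarrow> y \<in> carrier A \<Longrightarrow> x \<odot> \<sim> y = x \<ominus> y"
  by (simp add: mv_times_def diff_def)

text \<open>The hypothesis says that x + y stays at most 1, so that \<oplus> is not truncated and
  can be undone.\<close>

lemma plus_diff_cancel:
  assumes "x \<preceq> \<sim> y" "x \<in> carrier A" "y \<in> carrier A"
  shows "(x \<oplus> y) \<ominus> y = x"
proof -
  have "y \<preceq> \<sim> x" using assms le_neg_sym by simp
  then have "\<sim> (x \<oplus> y) \<oplus> y = \<sim> x" using assms diff_plus[of y "\<sim> x"] by (simp add: diff_def)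
  then show ?thesis using assms by (simp add: diff_def)
qed

lemma diff_neg_neg: "x \<in> carrier A \<Longrightarrow> y \<in> carrier A \<Longrightarrow> \<sim> x \<ominus> \<sim> y = y \<ominus> x"
  by (simp add: diff_def plus_comm)

text \<open>Both sides are the meet of x and y; this is the Lukasiewicz axiom for \<sim> x and
  \<sim> y, whose join is negated.\<close>

lemma diff_diff_comm: "x \<in> carrier A \<Longrightarrow> y \<in> carrier A \<Longrightarrow> x \<ominus> (x \<ominus> y) = y \<ominus> (y \<ominus> x)"
  using lukasiewicz[of "\<sim> x" "\<sim> y"] by (simp add: diff_def plus_comm)

text \<open>Untruncated addition is associative: if neither u + v nor (u + v) + w overflows, then
  neither does u + (v + w). It follows by cancelling v from
  \<open>u \<oplus> v \<preceq> v \<oplus> (\<sim> w \<ominus> v)\<close>.\<close>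

lemma orth_assoc:
  assumes "u \<preceq> \<sim> v" "u \<oplus> v \<preceq> \<sim> w" "u \<in> carrier A" "v \<in> carrier A" "w \<in> carrier A"
  shows "u \<preceq> \<sim> (v \<oplus> w)"
proof -
  have "u \<oplus> v \<preceq> v \<oplus> (\<sim> w \<ominus> v)"
    using le_trans[OF assms(2) le_diff_plus[of "\<sim> w" v]] assms by simp
  then have "(u \<oplus> v) \<ominus> v \<preceq> \<sim> w \<ominus> v" using diff_le_iff assms by simp
  moreover have "\<sim> w \<ominus> v = \<sim> (v \<oplus> w)" using assms by (simp add: diff_def plus_comm)
  ultimately show ?thesis using assms plus_diff_cancel[of u v] by simp
qed

lemma orth_assoc':
  assumes "v \<preceq> \<sim> w" "u \<preceq> \<sim> (v \<oplus> w)" "u \<in> carrier A" "v \<in> carrier A" "w \<in> carrier A"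
  shows "u \<oplus> v \<preceq> \<sim> w"
  using orth_assoc[of w v u] assms by (simp add: le_neg_sym plus_comm)

text \<open>Complementation turns the meet into the join
  \<open>(\<sim> y \<ominus> \<sim> x) \<oplus> \<sim> x\<close>, and residuation puts this join
  below the common upper bound \<sim> z.\<close>

lemma meet_greatest:
  assumes "z \<preceq> x" "z \<preceq> y" "x \<in> carrier A" "y \<in> carrier A" "z \<in> carrier A"
  shows "z \<preceq> x \<ominus> (x \<ominus> y)"
proof -
  have "\<sim> z = \<sim> x \<oplus> (\<sim> z \<ominus> \<sim> x)"
    using assms diff_plus[of "\<sim> x" "\<sim> z"] by (simp add: plus_comm)
  then have "\<sim> y \<preceq> \<sim> x \<oplus> (\<sim> z \<ominus> \<sim> x)"
    using assms neg_le_neg[of y z] by metis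
  then have "\<sim> y \<ominus> \<sim> x \<preceq> \<sim> z \<ominus> \<sim> x" using assms by (simp add: diff_le_iff)
  then have "(\<sim> y \<ominus> \<sim> x) \<oplus> \<sim> x \<preceq> (\<sim> z \<ominus> \<sim> x) \<oplus> \<sim> x"
    using assms plus_mono by simp
  also have "(\<sim> z \<ominus> \<sim> x) \<oplus> \<sim> x = \<sim> z"
    using assms diff_plus[of "\<sim> x" "\<sim> z"] by simp
  finally have 1: "(\<sim> y \<ominus> \<sim> x) \<oplus> \<sim> x \<preceq> \<sim> z" .
  have "x \<ominus> (x \<ominus> y) = \<sim> ((\<sim> y \<ominus> \<sim> x) \<oplus> \<sim> x)"
    using assms by (simp add: diff_def plus_comm)
  then show ?thesis using 1 assms le_neg_sym by simp
qed

text \<open>The left side is the meet of x with x \<ominus> y, which already lies below x. It is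
  used in the reading that x minus the meet of x and y is x \<ominus> y.\<close>

lemma meet_diff:
  assumes "x \<in> carrier A" "y \<in> carrier A"
  shows "x \<ominus> (x \<ominus> (x \<ominus> y)) = x \<ominus> y"
proof (rule le_antisym)
  show "x \<ominus> (x \<ominus> (x \<ominus> y)) \<preceq> x \<ominus> y"
    using assms diff_diff_comm[of x "x \<ominus> y"] by simp
  show "x \<ominus> y \<preceq> x \<ominus> (x \<ominus> (x \<ominus> y))"
    by (rule meet_greatest) (use assms in simp_all)
qed (use assms in simp_all)

text \<open>Prelinearity: x \<ominus> y and y \<ominus> x have meet zero. With m the meet of x and
  y, t \<oplus> m lies below both x and y, hence below m; since t + m does not overflow, cancelling
  m leaves t = \<zero>.\<close>

lemma prelinear:
  assumes "t \<preceq> x \<ominus> y" "t \<preceq> y \<ominus> x" and c: "t \<in> carrier A" "x \<in> carrier A" "y \<in> carrier A"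
  shows "t = \<zero>"
proof -
  define m where "m = x \<ominus> (x \<ominus> y)"
  have mc: "m \<in> carrier A" by (simp add: m_def c)
  have m': "m = y \<ominus> (y \<ominus> x)" unfolding m_def by (rule diff_diff_comm) fact+
  have xm: "x \<ominus> m = x \<ominus> y" unfolding m_def
    using meet_diff[of x y] c by simp
  have ym: "y \<ominus> m = y \<ominus> x" unfolding m'
    using meet_diff[of y x] c by simp
  have tx: "t \<oplus> m \<preceq> (x \<ominus> m) \<oplus> m" "t \<oplus> m \<preceq> (y \<ominus> m) \<oplus> m"
    using assms mc plus_mono xm ym by simp_all
  have "m \<preceq> x" unfolding m_def using c by simp
  moreover have "m \<preceq> y" unfolding m' using c by simp
  ultimately have "t \<oplus> m \<preceq> x" "t \<oplus> m \<preceq> y" using tx diff_plus c mc by simp_all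
  then have "t \<oplus> m \<preceq> m" using meet_greatest[of "t \<oplus> m" x y] c mc by (simp add: m_def)
  then have "(t \<oplus> m) \<ominus> m = \<zero>" using diff_eq_zero_iff c mc by simp
  moreover have "t \<preceq> \<sim> m"
    using le_trans[of t "x \<ominus> m" "\<sim> m"] diff_le_neg[of x m] assms(1) c mc by (simp add: xm)
  ultimately show ?thesis using plus_diff_cancel c mc by simp
qed

lemma diff_triangle:
  assumes "x \<in> carrier A" "y \<in> carrier A" "z \<in> carrier A"
  shows "x \<ominus> z \<preceq> (x \<ominus> y) \<oplus> (y \<ominus> z)"
proof -
  have "x \<preceq> y \<oplus> (x \<ominus> y)" using assms le_diff_plus by simp
  moreover have "y \<oplus> (x \<ominus> y) \<preceq> (z \<oplus> (y \<ominus> z)) \<oplus> (x \<ominus> y)"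
    using assms le_diff_plus plus_mono by simp
  ultimately have "x \<preceq> (z \<oplus> (y \<ominus> z)) \<oplus> (x \<ominus> y)"
    by (rule le_trans) (use assms in simp_all)
  then show ?thesis using assms by (simp add: diff_le_iff) (simp add: plus_ac)
qed

lemma plus_diff_plus:
  assumes "x \<in> carrier A" "y \<in> carrier A" "x' \<in> carrier A" "y' \<in> carrier A"
  shows "(x \<oplus> x') \<ominus> (y \<oplus> y') \<preceq> (x \<ominus> y) \<oplus> (x' \<ominus> y')"
proof -
  have "x \<oplus> x' \<preceq> (y \<oplus> (x \<ominus> y)) \<oplus> (y' \<oplus> (x' \<ominus> y'))"
    using assms le_diff_plus plus_mono by simp
  then show ?thesis using assms by (simp add: diff_le_iff plus_ac)
qed

section \<open>Finite multiples\<close>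

primrec nsum :: "nat \<Rightarrow> 'a \<Rightarrow> 'a" where
  "nsum 0 x = \<zero>"
| "nsum (Suc n) x = x \<oplus> nsum n x"

lemma nsum_closed [simp, intro]: "x \<in> carrier A \<Longrightarrow> nsum n x \<in> carrier A"
  by (induction n) auto

lemma nsum_add: "x \<in> carrier A \<Longrightarrow> nsum (m + n) x = nsum m x \<oplus> nsum n x"
  by (induction m) (auto simp: plus_assoc)

text \<open>If \<open>t\<close> is below \<open>n\<close> copies of \<open>v\<close> then \<open>t \<ominus> v\<close> is below \<open>n - 1\<close> of them.\<close>

lemma orth_nsum:
  assumes "\<And>s. s \<in> carrier A \<Longrightarrow> s \<preceq> u \<Longrightarrow> s \<preceq> v \<Longrightarrow> s = \<zero>"
    and "u \<in> carrier A" "v \<in> carrier A"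
  shows "t \<in> carrier A \<Longrightarrow> t \<preceq> u \<Longrightarrow> t \<preceq> nsum n v \<Longrightarrow> t = \<zero>"
proof (induction n arbitrary: t)
  case 0
  then show ?case by (simp add: le_zero_iff)
next
  case (Suc n)
  have "t \<ominus> v \<preceq> nsum n v" using Suc.prems assms by (simp add: diff_le_iff)
  moreover have "t \<ominus> v \<preceq> u"
    by (rule le_trans[of _ t]) (use Suc.prems assms in simp_all)
  ultimately have "t \<ominus> v = \<zero>" using Suc.IH[of "t \<ominus> v"] Suc.prems assms by simp
  then have "t \<preceq> v" using diff_eq_zero_iff Suc.prems assms by simp
  then show ?case using assms Suc.prems by blast
qed

section \<open>Ideals and quotients\<close>

lemma ideal_zero: "mv_ideal A I \<Longrightarrow> \<zero> \<in> I"
  and ideal_plus: "mv_ideal A I \<Longrightarrow> x \<in> I \<Longrightarrow> y \<in> I \<Longrightarrow> x \<oplus> y \<in> I"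
  and ideal_down: "mv_ideal A I \<Longrightarrow> x \<preceq> y \<Longrightarrow> y \<in> I \<Longrightarrow> x \<in> carrier A \<Longrightarrow> x \<in> I"
  and ideal_carrier: "mv_ideal A I \<Longrightarrow> x \<in> I \<Longrightarrow> x \<in> carrier A"
  unfolding mv_ideal_def by auto

lemma ideal_plus_iff:
  assumes "mv_ideal A I" "x \<in> carrier A" "y \<in> carrier A"
  shows "x \<oplus> y \<in> I \<longleftrightarrow> x \<in> I \<and> y \<in> I"
  using ideal_plus[OF assms(1), of x y] ideal_down[OF assms(1), of x "x \<oplus> y"]
    ideal_down[OF assms(1), of y "x \<oplus> y"] assms(2,3) by auto

lemma ideal_nsum: "mv_ideal A I \<Longrightarrow> x \<in> I \<Longrightarrow> nsum n x \<in> I"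
  by (induction n) (auto intro: ideal_zero ideal_plus)

lemma ideal_one: "mv_ideal A I \<Longrightarrow> \<one> \<in> I \<Longrightarrow> I = carrier A"
  using ideal_down[of I _ \<one>] ideal_carrier le_one by blast

text \<open>An ideal contains a sum iff it contains both summands, so the symmetric distance splits
  into the two one-sided differences, for which residuation is available.\<close>

lemma cong_iff:
  assumes "mv_ideal A I"
  shows "(x, y) \<in> mv_cong A I \<longleftrightarrow> x \<in> carrier A \<and> y \<in> carrier A \<and> x \<ominus> y \<in> I \<and> y \<ominus> x \<in> I"
  using ideal_plus_iff[OF assms, of "x \<ominus> y" "y \<ominus> x"]
  by (auto simp: mv_cong_def mv_dist_def times_neg)

lemma ideal_diff_trans:
  assumes "mv_ideal A I" "x \<in> carrier A" "y \<in> carrier A" "z \<in> carrier A"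
    and "x \<ominus> y \<in> I" "y \<ominus> z \<in> I"
  shows "x \<ominus> z \<in> I"
  using ideal_down[OF assms(1) diff_triangle[of x y z]] ideal_plus[OF assms(1,5,6)] assms(2-4)
  by simp

lemma equiv_cong:
  assumes I: "mv_ideal A I"
  shows "equiv (carrier A) (mv_cong A I)"
proof (rule equivI)
  show "mv_cong A I \<subseteq> carrier A \<times> carrier A" by (auto simp: mv_cong_def)
  have "x \<ominus> x \<in> I" if "x \<in> carrier A" for x
    using that diff_eq_zero_iff[of x x] ideal_zero[OF I] by simp
  then show "refl_on (carrier A) (mv_cong A I)"
    by (auto simp: refl_on_def cong_iff[OF I])
  show "sym (mv_cong A I)" by (auto simp: sym_def cong_iff[OF I])
  show "trans (mv_cong A I)"
    by (auto simp: trans_def cong_iff[OF I] intro: ideal_diff_trans[OF I])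
qed

abbreviation cls :: "'a set \<Rightarrow> 'a \<Rightarrow> 'a set" where "cls I x \<equiv> mv_cong A I `` {x}"

lemma cls_eq_iff:
  "mv_ideal A I \<Longrightarrow> x \<in> carrier A \<Longrightarrow> y \<in> carrier A
    \<Longrightarrow> cls I x = cls I y \<longleftrightarrow> x \<ominus> y \<in> I \<and> y \<ominus> x \<in> I"
  by (simp add: eq_equiv_class_iff[OF equiv_cong] cong_iff)

lemma cls_eq_zero_iff: "mv_ideal A I \<Longrightarrow> x \<in> carrier A \<Longrightarrow> cls I x = cls I \<zero> \<longleftrightarrow> x \<in> I"
  by (simp add: cls_eq_iff ideal_zero diff_def)

lemma quot_carrier: "carrier (mv_quot A I) = cls I ` carrier A"
  by (auto simp: mv_quot_def quotient_def)

lemma quot_zero: "\<zero>\<^bsub>mv_quot A I\<^esub> = cls I \<zero>"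
  by (simp add: mv_quot_def)

lemma quot_neg:
  assumes I: "mv_ideal A I" and "x \<in> carrier A"
  shows "\<sim>\<^bsub>mv_quot A I\<^esub> cls I x = cls I (\<sim> x)"
proof -
  have "congruent (mv_cong A I) (\<lambda>x. cls I (\<sim> x))"
  proof (rule congruentI)
    fix y z assume "(y, z) \<in> mv_cong A I"
    then show "cls I (\<sim> y) = cls I (\<sim> z)"
      unfolding cong_iff[OF I] using cls_eq_iff[OF I, of "\<sim> y" "\<sim> z"]
      by (simp add: diff_neg_neg)
  qed
  then show ?thesis
    using UN_equiv_class[OF equiv_cong[OF I]] assms(2) by (simp add: mv_quot_def)
qed

lemma quot_plus:
  assumes I: "mv_ideal A I" and "x \<in> carrier A" "y \<in> carrier A"
  shows "cls I x \<oplus>\<^bsub>mv_quot A I\<^esub> cls I y = cls I (x \<oplus> y)"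
proof -
  have "(a \<oplus> c) \<ominus> (b \<oplus> d) \<in> I" if "a \<ominus> b \<in> I" "c \<ominus> d \<in> I"
    "a \<in> carrier A" "b \<in> carrier A" "c \<in> carrier A" "d \<in> carrier A" for a b c d
    using ideal_down[OF I plus_diff_plus[of a b c d]] ideal_plus[OF I that(1,2)] that by simp
  then have "cls I (a \<oplus> c) = cls I (b \<oplus> d)"
    if "(a, b) \<in> mv_cong A I" "(c, d) \<in> mv_cong A I" for a b c d
    using that cls_eq_iff[OF I, of "a \<oplus> c" "b \<oplus> d"] unfolding cong_iff[OF I] by simp
  then have "congruent2 (mv_cong A I) (mv_cong A I) (\<lambda>x y. cls I (x \<oplus> y))"
    by (rule congruent2I')
  then show ?thesis
    using UN_equiv_class2[OF equiv_cong[OF I] equiv_cong[OF I]] assms(2,3)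
    by (simp add: mv_quot_def)
qed

lemma mv_algebra_quot:
  assumes I: "mv_ideal A I"
  shows "mv_algebra (mv_quot A I)"
proof -
  note q = quot_carrier quot_zero quot_neg[OF I] quot_plus[OF I]
  show ?thesis
  proof
    fix x y assume "x \<in> carrier (mv_quot A I)" "y \<in> carrier (mv_quot A I)"
    then obtain a b where "a \<in> carrier A" "b \<in> carrier A" "x = cls I a" "y = cls I b"
      by (auto simp: quot_carrier)
    then show "\<sim>\<^bsub>mv_quot A I\<^esub> (\<sim>\<^bsub>mv_quot A I\<^esub> x \<oplus>\<^bsub>mv_quot A I\<^esub> y) \<oplus>\<^bsub>mv_quot A I\<^esub> y =
        \<sim>\<^bsub>mv_quot A I\<^esub> (\<sim>\<^bsub>mv_quot A I\<^esub> y \<oplus>\<^bsub>mv_quot A I\<^esub> x) \<oplus>\<^bsub>mv_quot A I\<^esub> x"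
      by (simp add: q lukasiewicz)
  next
    fix x y assume "x \<in> carrier (mv_quot A I)" "y \<in> carrier (mv_quot A I)"
    then show "x \<oplus>\<^bsub>mv_quot A I\<^esub> y = y \<oplus>\<^bsub>mv_quot A I\<^esub> x"
      by (auto simp: q plus_comm)
  qed (auto simp: q plus_assoc)
qed

section \<open>Maximal ideals and simple quotients\<close>

lemma max_ideal_ideal: "M \<in> max_ideals A \<Longrightarrow> mv_ideal A M"
  by (simp add: max_ideals_def)

lemma max_ideal_one: "M \<in> max_ideals A \<Longrightarrow> \<one> \<notin> M"
  using ideal_one by (auto simp: max_ideals_def)

lemma max_ideal_eqI:
  "M \<in> max_ideals A \<Longrightarrow> mv_ideal A I \<Longrightarrow> M \<subseteq> I \<Longrightarrow> I \<noteq> carrier A \<Longrightarrow> I = M"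
  by (auto simp: max_ideals_def)

lemma ideal_adjoin:
  assumes M: "mv_ideal A M" and a: "a \<in> carrier A"
  shows "mv_ideal A {x \<in> carrier A. \<exists>m\<in>M. \<exists>n. x \<preceq> m \<oplus> nsum n a}" (is "mv_ideal A ?I")
  unfolding mv_ideal_def
proof (intro conjI ballI impI)
  show "?I \<subseteq> carrier A" by blast
next
  have "\<zero> \<preceq> \<zero> \<oplus> nsum 0 a" by simp
  then show "\<zero> \<in> ?I" using ideal_zero[OF M] zero_closed by (intro CollectI conjI bexI exI)
next
  fix x y assume "x \<in> ?I" "y \<in> ?I"
  then obtain m n m' n' where *: "m \<in> M" "x \<preceq> m \<oplus> nsum n a" "m' \<in> M" "y \<preceq> m' \<oplus> nsum n' a"
    "x \<in> carrier A" "y \<in> carrier A" by auto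
  have "m \<in> carrier A" "m' \<in> carrier A" using * ideal_carrier[OF M] by auto
  then have "x \<oplus> y \<preceq> (m \<oplus> m') \<oplus> nsum (n + n') a"
    using plus_mono[OF *(2,4)] * a by (simp add: nsum_add plus_ac)
  moreover have "m \<oplus> m' \<in> M" "x \<oplus> y \<in> carrier A" using * ideal_plus[OF M] by simp_all
  ultimately show "x \<oplus> y \<in> ?I" by (intro CollectI conjI bexI exI)
next
  fix x y assume "x \<in> carrier A" "y \<in> ?I" "x \<preceq> y"
  moreover from this obtain m n where "m \<in> M" "y \<preceq> m \<oplus> nsum n a" by auto
  moreover have "m \<in> carrier A" using calculation ideal_carrier[OF M] by auto
  ultimately have "x \<preceq> m \<oplus> nsum n a" using le_trans[of x y "m \<oplus> nsum n a"] a by simp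
  then show "x \<in> ?I" using \<open>m \<in> M\<close> \<open>x \<in> carrier A\<close> by (intro CollectI conjI bexI exI)
qed

text \<open>The ideal generated by M and a is strictly larger than M, so it contains \<one>. Modulo
  M this says that some multiple of a is \<one>, the Archimedean property of the quotient.\<close>

lemma max_ideal_adjoin:
  assumes M: "M \<in> max_ideals A" and a: "a \<in> carrier A" "a \<notin> M"
  obtains m n where "m \<in> M" "m \<oplus> nsum n a = \<one>"
proof -
  note I = max_ideal_ideal[OF M]
  let ?I = "{x \<in> carrier A. \<exists>m\<in>M. \<exists>n. x \<preceq> m \<oplus> nsum n a}"
  have "x \<preceq> x \<oplus> nsum 0 a" if "x \<in> M" for x using ideal_carrier[OF I that] by simp
  then have "M \<subseteq> ?I" using ideal_carrier[OF I] by blast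
  moreover have "a \<preceq> \<zero> \<oplus> nsum 1 a" using a by simp
  then have "a \<in> ?I" using a ideal_zero[OF I] by blast
  ultimately have "?I = carrier A"
    using max_ideal_eqI[OF M ideal_adjoin[OF I a(1)]] a(2) by blast
  then have "\<one> \<in> ?I" by (simp only: one_closed)
  then obtain m n where "m \<in> M" "\<one> \<preceq> m \<oplus> nsum n a" by blast
  then show ?thesis using that[of m n] one_le_iff ideal_carrier[OF I] a by simp
qed

end

locale mv_chain = mv_algebra +
  assumes total: "x \<in> carrier A \<Longrightarrow> y \<in> carrier A \<Longrightarrow> x \<preceq> y \<or> y \<preceq> x"
    and zero_neq_one: "\<zero> \<noteq> \<one>"

locale simple_mv_algebra = mv_chain +
  assumes archimedean: "x \<in> carrier A \<Longrightarrow> x \<noteq> \<zero> \<Longrightarrow> \<exists>n. nsum n x = \<one>"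

text \<open>Totality comes out of the Archimedean property. If neither difference of x and y were
  zero, a multiple of y \<ominus> x would be \<one> and so lie above x \<ominus> y; but the
  differences have meet zero, which \<open>orth_nsum\<close> extends to multiples, so x \<ominus> y
  would be zero.\<close>

lemma (in mv_algebra) simple_quot:
  assumes M: "M \<in> max_ideals A"
  shows "simple_mv_algebra (mv_quot A M)"
proof -
  note I = max_ideal_ideal[OF M]
  interpret Q: mv_algebra "mv_quot A M" by (rule mv_algebra_quot[OF I])
  have one: "\<one>\<^bsub>mv_quot A M\<^esub> = cls M \<one>"
    by (simp add: mv_one_def[of "mv_quot A M"] quot_zero quot_neg[OF I])
  have nsum: "Q.nsum n (cls M a) = cls M (nsum n a)" if "a \<in> carrier A" for n a
    by (induction n) (simp_all add: quot_zero quot_plus[OF I] that)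
  have arch: "\<exists>n. Q.nsum n x = \<one>\<^bsub>mv_quot A M\<^esub>"
    if x: "x \<in> carrier (mv_quot A M)" "x \<noteq> \<zero>\<^bsub>mv_quot A M\<^esub>" for x
  proof -
    obtain a where a: "a \<in> carrier A" "x = cls M a" using x by (auto simp: quot_carrier)
    then have "a \<notin> M" using x cls_eq_zero_iff[OF I a(1)] by (simp add: quot_zero)
    then obtain m n where mn: "m \<in> M" "m \<oplus> nsum n a = \<one>" using max_ideal_adjoin[OF M a(1)] by blast
    have mc: "m \<in> carrier A" using mn ideal_carrier[OF I] by blast
    then have "cls M \<one> = cls M m \<oplus>\<^bsub>mv_quot A M\<^esub> cls M (nsum n a)"
      using a(1) by (simp add: quot_plus[OF I] mn)
    also have "cls M m = \<zero>\<^bsub>mv_quot A M\<^esub>" using cls_eq_zero_iff[OF I mc] mn by (simp add: quot_zero)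
    finally have "cls M (nsum n a) = cls M \<one>" using a(1) by (simp add: quot_carrier)
    then show ?thesis using nsum a one by metis
  qed
  show ?thesis
  proof
    fix x y assume c: "x \<in> carrier (mv_quot A M)" "y \<in> carrier (mv_quot A M)"
    show "Q.le x y \<or> Q.le y x"
    proof (rule ccontr)
      assume "\<not> (Q.le x y \<or> Q.le y x)"
      then have n: "Q.diff x y \<noteq> \<zero>\<^bsub>mv_quot A M\<^esub>" "Q.diff y x \<noteq> \<zero>\<^bsub>mv_quot A M\<^esub>"
        using Q.diff_eq_zero_iff c by auto
      then obtain n where "Q.nsum n (Q.diff y x) = \<one>\<^bsub>mv_quot A M\<^esub>" using arch c by blast
      then have "Q.diff x y = \<zero>\<^bsub>mv_quot A M\<^esub>"
        using Q.orth_nsum[of "Q.diff x y" "Q.diff y x" "Q.diff x y" n] Q.prelinear[of _ x y] c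
        by simp
      then show False using n by simp
    qed
  next
    show "\<zero>\<^bsub>mv_quot A M\<^esub> \<noteq> \<one>\<^bsub>mv_quot A M\<^esub>"
      using cls_eq_zero_iff[OF I, of \<one>] max_ideal_one[OF M] by (simp add: quot_zero one)
  qed (rule arch)
qed

section \<open>Real values in a chain\<close>

text \<open>The value of \<open>x\<close> in $[0,1]$ is read off its binary expansion, obtained by iterating the
  doubling map. That it is additive is proved in the symmetric form that \<open>a + b + c = 1\<close> implies
  the same for the values: doubling turns such a triple into another one, up to negation of all
  three entries, and halves the defect of the values.\<close>

context mv_chain
begin

definition dbl :: "'a \<Rightarrow> 'a" where
  "dbl x = (if x \<preceq> \<sim> x then x \<oplus> x else x \<odot> x)"

text \<open>At x = \<sim> x the digit is 0 and the double is \<one>: one half is expanded as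
  0.0111..., and \<one>, a fixed point of \<open>dbl\<close>, as 0.111... .\<close>

definition digit :: "'a \<Rightarrow> real" where
  "digit x = (if x \<preceq> \<sim> x then 0 else 1)"

definition val :: "'a \<Rightarrow> real" where
  "val x = (\<Sum>n. digit ((dbl ^^ n) x) * (1/2) ^ Suc n)"

lemma dbl_closed [simp, intro]: "x \<in> carrier A \<Longrightarrow> dbl x \<in> carrier A"
  by (simp add: dbl_def)

lemma summable_digits: "summable (\<lambda>n. digit (X n) * (1/2) ^ Suc n)"
  by (rule summable_comparison_test[OF _ sums_summable[OF power_half_series]])
    (auto simp: digit_def)

text \<open>The first term of the series is split off. Together with the bounds 0 and 1, this
  recursion is all that the later proofs about values use.\<close>

lemma val_rec: "val x = (digit x + val (dbl x)) / 2"
proof -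
  let ?f = "\<lambda>n. digit ((dbl ^^ n) x) * (1/2) ^ Suc n"
  have "val (dbl x) / 2 = (\<Sum>n. ?f (Suc n))"
    unfolding val_def suminf_divide[OF summable_digits, symmetric]
    by (simp add: funpow_swap1)
  also have "\<dots> = val x - ?f 0"
    unfolding val_def by (rule suminf_split_head[OF summable_digits])
  finally show ?thesis by (simp add: field_simps)
qed

lemma val_nonneg: "0 \<le> val x"
  unfolding val_def by (rule suminf_nonneg[OF summable_digits]) (simp add: digit_def)

lemma val_le_1: "val x \<le> 1"
proof -
  have "val x \<le> (\<Sum>n. (1/2) ^ Suc n)"
    unfolding val_def
    by (rule suminf_le[OF _ summable_digits sums_summable[OF power_half_series]])
      (simp add: digit_def)
  then show ?thesis using sums_unique[OF power_half_series] by simp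
qed

lemma val_one: "val \<one> = 1"
proof -
  have "\<not> \<one> \<preceq> \<zero>" using le_zero_iff zero_neq_one by auto
  then show ?thesis using val_rec[of \<one>] by (simp add: dbl_def digit_def mv_times_def)
qed

text \<open>Away from x = \<sim> x, doubling commutes with negation and the digits of x and \<sim> x
  add up to 1, so each step halves the defect of the equation. The defect is at most 1 at the start,
  hence at most any power of 1/2.\<close>

lemma val_neg:
  assumes "x \<in> carrier A"
  shows "val (\<sim> x) = 1 - val x"
proof -
  have "\<bar>val x + val (\<sim> x) - 1\<bar> \<le> (1/2) ^ n" if "x \<in> carrier A" for x n
    using that
  proof (induction n arbitrary: x)
    case 0
    show ?case using val_nonneg[of x] val_le_1[of x] val_nonneg[of "\<sim> x"] val_le_1[of "\<sim> x"]
      by (simp add: abs_if)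
  next
    case (Suc n)
    consider "x = \<sim> x" | "x \<preceq> \<sim> x" "\<not> \<sim> x \<preceq> x" | "\<sim> x \<preceq> x" "\<not> x \<preceq> \<sim> x"
      using total[of x "\<sim> x"] le_antisym[of x "\<sim> x"] Suc.prems by auto
    then show ?case
    proof cases
      case 1
      \<comment> \<open>Here both digits are 0 and both doubles are \<one>, so negation does not
        commute with doubling; the value is computed outright as 1/2.\<close>
      then have "x \<preceq> \<sim> x" using le_refl[OF Suc.prems] by metis
      moreover have "x \<oplus> x = \<one>" using 1 plus_neg_self[OF Suc.prems] by metis
      ultimately have "val x = 1 / 2" using val_rec[of x] by (simp add: dbl_def digit_def val_one)
      moreover have "val (\<sim> x) = val x" using 1 by metis
      ultimately have eq: "val x + val (\<sim> x) - 1 = 0" by simp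
      show ?thesis unfolding eq by simp
    next
      case 2
      then have "dbl x = x \<oplus> x" "dbl (\<sim> x) = \<sim> (x \<oplus> x)" "digit x = 0" "digit (\<sim> x) = 1"
        using Suc.prems by (simp_all add: dbl_def digit_def mv_times_def)
      then have eq: "val x + val (\<sim> x) - 1 = (val (x \<oplus> x) + val (\<sim> (x \<oplus> x)) - 1) / 2"
        using val_rec[of x] val_rec[of "\<sim> x"] by simp
      show ?thesis unfolding eq using Suc.IH[of "x \<oplus> x"] Suc.prems by simp
    next
      case 3
      then have "dbl (\<sim> x) = \<sim> x \<oplus> \<sim> x" "dbl x = \<sim> (\<sim> x \<oplus> \<sim> x)" "digit x = 1" "digit (\<sim> x) = 0"
        using Suc.prems by (simp_all add: dbl_def digit_def mv_times_def)
      then have eq: "val x + val (\<sim> x) - 1 = (val (\<sim> x \<oplus> \<sim> x) + val (\<sim> (\<sim> x \<oplus> \<sim> x)) - 1) / 2"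
        using val_rec[of x] val_rec[of "\<sim> x"] by simp
      show ?thesis unfolding eq using Suc.IH[of "\<sim> x \<oplus> \<sim> x"] Suc.prems by simp
    qed
  qed
  from this[OF assms] have "\<bar>val x + val (\<sim> x) - 1\<bar> \<le> 0"
    by (intro LIMSEQ_le_const[OF LIMSEQ_power_zero[of "1/2::real"]]) auto
  then show ?thesis by simp
qed

text \<open>Three elements with real sum 1: the condition on a and b excludes overflow, and c is
  what is missing to 1. The relation is symmetric although it is not written so; the two swaps below
  show this.\<close>

definition triple :: "'a \<Rightarrow> 'a \<Rightarrow> 'a \<Rightarrow> bool" where
  "triple a b c \<longleftrightarrow> a \<in> carrier A \<and> b \<in> carrier A \<and> a \<preceq> \<sim> b \<and> c = \<sim> (a \<oplus> b)"

lemma triple_swap12: "triple a b c \<Longrightarrow> triple b a c"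
  by (auto simp: triple_def le_neg_sym plus_comm)

lemma triple_swap23: "triple a b c \<Longrightarrow> triple a c b"
  using plus_diff_cancel[of b a] le_neg_sym[of a b] le_plus1[of a b]
  by (simp add: triple_def diff_def plus_comm)

lemma triple_neg:
  assumes "triple a b c"
  shows "\<sim> a = b \<oplus> c"
  using triple_swap23[OF triple_swap12[OF assms]] by (auto simp: triple_def)

text \<open>If a exceeds one half, then b + c = 1 - a does not, so 2b + 2c does not overflow and (2a
  - 1) + 2b + 2c = 1. The digits removed are 1, 0, 0.\<close>

lemma triple_dbl_big:
  assumes t: "triple a b c" and a: "\<not> a \<preceq> \<sim> a"
  shows "b \<preceq> \<sim> b" "c \<preceq> \<sim> c" "triple (dbl a) (dbl b) (dbl c)"
proof -
  have small: "y \<preceq> \<sim> y" if "triple a y z" for y z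
  proof -
    have c: "a \<in> carrier A" "y \<in> carrier A" using that by (auto simp: triple_def)
    have "\<sim> a \<preceq> a" using a total[of a "\<sim> a"] c by auto
    moreover have "a \<preceq> \<sim> y" "y \<preceq> \<sim> a" using that c by (simp_all add: triple_def le_neg_sym)
    ultimately show ?thesis
      using le_trans[of y "\<sim> a" a] le_trans[of y a "\<sim> y"] c by simp
  qed
  show b: "b \<preceq> \<sim> b" by (rule small[OF t])
  show c: "c \<preceq> \<sim> c" by (rule small[OF triple_swap23[OF t]])
  have cl: "a \<in> carrier A" "b \<in> carrier A" "c \<in> carrier A" using t by (auto simp: triple_def)
  have bc: "b \<preceq> \<sim> c" using triple_swap23[OF triple_swap12[OF t]] by (simp add: triple_def)
  have na: "\<sim> a = b \<oplus> c" by (rule triple_neg[OF t])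
  have "\<sim> a \<preceq> \<sim> (\<sim> a)" using a total[of a "\<sim> a"] cl by auto
  then have "c \<oplus> b \<preceq> \<sim> (b \<oplus> c)" unfolding na using cl by (simp add: plus_comm)
  then have "c \<preceq> \<sim> (b \<oplus> (b \<oplus> c))"
    using orth_assoc[of c b "b \<oplus> c"] bc cl by (simp add: le_neg_sym)
  then have *: "(b \<oplus> b) \<oplus> c \<preceq> \<sim> c" using cl by (simp add: plus_assoc le_neg_sym)
  then have "b \<oplus> b \<preceq> \<sim> c" using le_trans[of "b \<oplus> b" "(b \<oplus> b) \<oplus> c" "\<sim> c"] cl by simp
  then have "b \<oplus> b \<preceq> \<sim> (c \<oplus> c)" using orth_assoc[of "b \<oplus> b" c c] * cl by simp
  moreover have "a \<odot> a = \<sim> ((b \<oplus> b) \<oplus> (c \<oplus> c))"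
    using cl by (simp add: mv_times_def na plus_ac)
  ultimately have "triple (b \<oplus> b) (c \<oplus> c) (a \<odot> a)" using cl by (simp add: triple_def)
  from triple_swap12[OF triple_swap23[OF this]] show "triple (dbl a) (dbl b) (dbl c)"
    using a b c by (simp add: dbl_def)
qed

text \<open>In real arithmetic, 1 - 2a = (b + c) - a = b + (c - a); \<open>orth_assoc'\<close> shows
  that the cancellation of a is free of overflow.\<close>

lemma triple_neg_dbl:
  assumes t: "triple a b c" and "a \<preceq> c"
  shows "\<sim> (a \<oplus> a) = b \<oplus> (c \<ominus> a)"
proof -
  have cl: "a \<in> carrier A" "b \<in> carrier A" "c \<in> carrier A" using t by (auto simp: triple_def)
  have c: "(c \<ominus> a) \<oplus> a = c" by (rule diff_plus) fact+
  have "b \<preceq> \<sim> c" using triple_swap23[OF triple_swap12[OF t]] by (simp add: triple_def)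
  then have "b \<oplus> (c \<ominus> a) \<preceq> \<sim> a" using orth_assoc'[of "c \<ominus> a" a b] cl c by simp
  then have "((b \<oplus> (c \<ominus> a)) \<oplus> a) \<ominus> a = b \<oplus> (c \<ominus> a)" using plus_diff_cancel cl by simp
  then have "(b \<oplus> c) \<ominus> a = b \<oplus> (c \<ominus> a)" using cl c by (simp add: plus_assoc)
  moreover have "\<sim> (a \<oplus> a) = \<sim> a \<ominus> a" using cl by (simp add: diff_def)
  ultimately show ?thesis by (simp add: triple_neg[OF t])
qed

text \<open>With all entries at most one half, the doubles have sum 2, so it is their complements
  that have sum 3 - 2 = 1.\<close>

lemma triple_dbl_small:
  assumes t: "triple a b c" and s: "a \<preceq> \<sim> a" "b \<preceq> \<sim> b" "c \<preceq> \<sim> c"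
  shows "triple (\<sim> (dbl a)) (\<sim> (dbl b)) (\<sim> (dbl c))"
proof -
  \<comment> \<open>The case in which c is the largest entry; the others follow by permuting. Then 1
    - 2a = b + (c - a) and 1 - 2b = a + (c - b) add up to 2c.\<close>
  have main: "triple (\<sim> (a \<oplus> a)) (\<sim> (b \<oplus> b)) (\<sim> (c \<oplus> c))"
    if t: "triple a b c" and c: "c \<preceq> \<sim> c" and le: "a \<preceq> c" "b \<preceq> c" for a b c
  proof -
    have cl: "a \<in> carrier A" "b \<in> carrier A" "c \<in> carrier A" using t by (auto simp: triple_def)
    have "(a \<oplus> b) \<oplus> (a \<oplus> b) = \<one>"
      using c t by (simp add: triple_def mv_le_def)
    then have "\<sim> (a \<oplus> a) \<preceq> \<sim> (\<sim> (b \<oplus> b))" using cl by (simp add: mv_le_def plus_ac)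
    moreover have "\<sim> (a \<oplus> a) \<oplus> \<sim> (b \<oplus> b) = ((c \<ominus> b) \<oplus> b) \<oplus> ((c \<ominus> a) \<oplus> a)"
      unfolding triple_neg_dbl[OF t le(1)] triple_neg_dbl[OF triple_swap12[OF t] le(2)]
      using cl by (simp add: plus_ac)
    then have "\<sim> (a \<oplus> a) \<oplus> \<sim> (b \<oplus> b) = c \<oplus> c" using diff_plus le cl by simp
    ultimately show ?thesis using cl by (simp add: triple_def)
  qed
  have cl: "a \<in> carrier A" "b \<in> carrier A" "c \<in> carrier A" using t by (auto simp: triple_def)
  consider "a \<preceq> c" "b \<preceq> c" | "a \<preceq> b" "c \<preceq> b" | "b \<preceq> a" "c \<preceq> a"
    using total[OF cl(1,2)] total[OF cl(1,3)] total[OF cl(2,3)] le_trans[OF _ _ cl]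
      le_trans[OF _ _ cl(2,1,3)] le_trans[OF _ _ cl(1,3,2)] by blast
  then have "triple (\<sim> (a \<oplus> a)) (\<sim> (b \<oplus> b)) (\<sim> (c \<oplus> c))"
  proof cases
    case 1 then show ?thesis using main t s by blast
  next
    case 2 then show ?thesis using main[OF triple_swap23[OF t] s(2)] triple_swap23 by blast
  next
    case 3
    then show ?thesis using main[OF triple_swap23[OF triple_swap12[OF t]] s(1)]
      triple_swap12 triple_swap23 by blast
  qed
  then show ?thesis using s by (simp add: dbl_def)
qed

lemma val_triple:
  assumes "triple a b c"
  shows "val a + val b + val c = 1"
proof -
  \<comment> \<open>Three values in [0,1] miss the sum 1 by at most 2, which explains the
    factor.\<close>
  have "\<bar>val a + val b + val c - 1\<bar> \<le> 2 * (1/2) ^ n" if "triple a b c" for a b c n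
    using that
  proof (induction n arbitrary: a b c)
    case 0
    show ?case using val_nonneg[of a] val_le_1[of a] val_nonneg[of b] val_le_1[of b]
      val_nonneg[of c] val_le_1[of c] by (simp add: abs_if)
  next
    case (Suc n)
    have big: "\<bar>val a + val b + val c - 1\<bar> \<le> 2 * (1/2) ^ Suc n"
      if t: "triple a b c" and a: "\<not> a \<preceq> \<sim> a" for a b c
      using Suc.IH[OF triple_dbl_big(3)[OF t a]] triple_dbl_big(1,2)[OF t a] a
        val_rec[of a] val_rec[of b] val_rec[of c] by (simp add: digit_def)
    show ?case
    proof (cases "a \<preceq> \<sim> a \<and> b \<preceq> \<sim> b \<and> c \<preceq> \<sim> c")
      case True
      \<comment> \<open>The digits vanish and the next triple consists of complements, so by
        \<open>val_neg\<close> the defect changes sign while it is halved.\<close>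
      then show ?thesis
        using Suc.IH[OF triple_dbl_small[OF Suc.prems]] Suc.prems
          val_rec[of a] val_rec[of b] val_rec[of c]
        by (simp add: digit_def val_neg triple_def)
    next
      case False
      then show ?thesis
        using big[OF Suc.prems] big[OF triple_swap12[OF Suc.prems]]
          big[OF triple_swap12[OF triple_swap23[OF Suc.prems]]]
        by (auto simp: add_ac)
    qed
  qed
  from this[OF assms] have "\<bar>val a + val b + val c - 1\<bar> \<le> 2 * 0"
    by (intro LIMSEQ_le_const[OF tendsto_mult[OF tendsto_const LIMSEQ_power_zero[of "1/2::real"]]])
      auto
  then show ?thesis by simp
qed

lemma val_plus_orth:
  assumes "x \<preceq> \<sim> y" "x \<in> carrier A" "y \<in> carrier A"
  shows "val (x \<oplus> y) = val x + val y"
  using val_triple[of x y "\<sim> (x \<oplus> y)"] assms val_neg[of "x \<oplus> y"] by (simp add: triple_def)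

lemma val_plus:
  assumes "x \<in> carrier A" "y \<in> carrier A"
  shows "val (x \<oplus> y) = min 1 (val x + val y)"
proof (cases "x \<preceq> \<sim> y")
  case True
  then show ?thesis using val_plus_orth[of x y] assms val_le_1[of "x \<oplus> y"] by simp
next
  case False
  then have le: "\<sim> y \<preceq> x" using total assms by auto
  then have "x \<oplus> y = \<one>" using assms by (simp add: mv_le_def plus_comm)
  \<comment> \<open>Here x is the untruncated sum of \<open>x \<ominus> \<sim> y\<close> and \<sim>
    y, so val x is at least 1 - val y and the minimum is 1.\<close>
  moreover have "val x = val (x \<ominus> \<sim> y) + val (\<sim> y)"
    using val_plus_orth[of "x \<ominus> \<sim> y" "\<sim> y"] diff_plus[OF le] diff_le_neg[of x "\<sim> y"] assms by simp
  ultimately show ?thesis using val_neg[OF assms(2)] val_nonneg[of "x \<ominus> \<sim> y"] by (simp add: val_one)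
qed

lemma val_hom: "restrict val (carrier A) \<in> mv_hom A unit_interval"
  using val_neg[of \<one>]
  by (auto simp: mv_hom_def unit_interval_def val_nonneg val_le_1 val_plus val_neg val_one)

end

section \<open>Homomorphisms to the unit interval\<close>

context mv_algebra
begin

context
  fixes \<psi>
  assumes \<psi>: "\<psi> \<in> mv_hom A unit_interval"
begin

lemma unit_hom_bounds: "x \<in> carrier A \<Longrightarrow> 0 \<le> \<psi> x \<and> \<psi> x \<le> 1"
  using \<psi> by (auto simp: mv_hom_def unit_interval_def)

lemma unit_hom_plus: "x \<in> carrier A \<Longrightarrow> y \<in> carrier A \<Longrightarrow> \<psi> (x \<oplus> y) = min 1 (\<psi> x + \<psi> y)"
  using \<psi> by (auto simp: mv_hom_def unit_interval_def)

lemma unit_hom_neg: "x \<in> carrier A \<Longrightarrow> \<psi> (\<sim> x) = 1 - \<psi> x"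
  using \<psi> by (auto simp: mv_hom_def unit_interval_def)

lemma unit_hom_zero: "\<psi> \<zero> = 0"
  using \<psi> by (auto simp: mv_hom_def unit_interval_def)

lemma unit_hom_one: "\<psi> \<one> = 1"
  using unit_hom_neg[OF zero_closed] by (simp add: unit_hom_zero)

lemma unit_hom_times:
  "x \<in> carrier A \<Longrightarrow> y \<in> carrier A \<Longrightarrow> \<psi> (x \<odot> y) = max 0 (\<psi> x + \<psi> y - 1)"
  by (simp add: mv_times_def unit_hom_neg unit_hom_plus)

lemma unit_hom_diff:
  "x \<in> carrier A \<Longrightarrow> y \<in> carrier A \<Longrightarrow> \<psi> (x \<ominus> y) = max 0 (\<psi> x - \<psi> y)"
  by (simp add: diff_def unit_hom_neg unit_hom_plus)

lemma unit_hom_mono: "x \<in> carrier A \<Longrightarrow> y \<in> carrier A \<Longrightarrow> x \<preceq> y \<Longrightarrow> \<psi> x \<le> \<psi> y"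
  using unit_hom_diff[of x y] diff_eq_zero_iff[of x y] by (simp add: unit_hom_zero)

lemma unit_hom_nsum: "x \<in> carrier A \<Longrightarrow> \<psi> (nsum n x) = min 1 (real n * \<psi> x)"
  using unit_hom_bounds[of x]
  by (induction n) (auto simp: unit_hom_zero unit_hom_plus algebra_simps min_def)

lemma unit_hom_nsum_one:
  assumes "x \<in> carrier A" "\<psi> x > 0"
  obtains n where "\<psi> (nsum n x) = 1"
proof -
  obtain n where "1 < real n * \<psi> x" using ex_less_of_nat_mult[OF assms(2)] by blast
  then show ?thesis using that[of n] unit_hom_nsum[of x n] assms by simp
qed

lemma unit_hom_ideal: "mv_ideal A {a \<in> carrier A. \<psi> a = 0}"
  unfolding mv_ideal_def
proof (intro conjI ballI impI)
  fix x y assume "x \<in> carrier A" "y \<in> {a \<in> carrier A. \<psi> a = 0}" "x \<preceq> y"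
  then show "x \<in> {a \<in> carrier A. \<psi> a = 0}"
    using unit_hom_mono[of x y] unit_hom_bounds[of x] by simp
qed (auto simp: unit_hom_zero unit_hom_plus)

text \<open>An element of positive value has a multiple of value 1, whose negation lies in the
  kernel; an ideal containing that element and the kernel therefore contains \<one>.\<close>

lemma unit_hom_max_ideal: "{a \<in> carrier A. \<psi> a = 0} \<in> max_ideals A"
  unfolding max_ideals_def
proof (intro CollectI conjI allI impI)
  let ?K = "{a \<in> carrier A. \<psi> a = 0}"
  show "mv_ideal A ?K" by (rule unit_hom_ideal)
  show "?K \<noteq> carrier A" using unit_hom_one one_closed by force
  fix I assume I: "mv_ideal A I \<and> ?K \<subseteq> I"
  show "I = ?K \<or> I = carrier A"
  proof (rule disjCI)
    assume "I \<noteq> carrier A"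
    have "\<psi> x = 0" if "x \<in> I" for x
    proof (rule ccontr)
      assume "\<psi> x \<noteq> 0"
      have x: "x \<in> carrier A" using I ideal_carrier that by blast
      then have "\<psi> x > 0" using unit_hom_bounds[of x] \<open>\<psi> x \<noteq> 0\<close> by simp
      then obtain n where "\<psi> (nsum n x) = 1" using unit_hom_nsum_one x by blast
      then have "\<sim> (nsum n x) \<in> ?K" using x by (simp add: unit_hom_neg)
      then have "nsum n x \<oplus> \<sim> (nsum n x) \<in> I"
        using I ideal_plus ideal_nsum that by blast
      then show False using ideal_one I \<open>I \<noteq> carrier A\<close> x by simp
    qed
    then show "I = ?K" using I ideal_carrier by blast
  qed
qed

end

lemma unit_hom_eqI_ker:
  assumes f: "f \<in> mv_hom A unit_interval" and g: "g \<in> mv_hom A unit_interval"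
    and ker: "\<And>x. x \<in> carrier A \<Longrightarrow> f x = 0 \<longleftrightarrow> g x = 0" and x: "x \<in> carrier A"
  shows "f x = g x"
proof -
  note hom = unit_hom_plus[OF f] unit_hom_plus[OF g] unit_hom_times[OF f] unit_hom_times[OF g]
  have "\<bar>f x - g x\<bar> \<le> (1/2) ^ n" if "x \<in> carrier A" for n x
    using that
  proof (induction n arbitrary: x)
    case 0
    then show ?case using unit_hom_bounds[OF f, of x] unit_hom_bounds[OF g, of x] by auto
  next
    case (Suc n)
    note x = Suc.prems
    have tt: "x \<odot> x \<in> carrier A" "x \<oplus> x \<in> carrier A" using x by simp_all
    \<comment> \<open>The value of \<open>x \<odot> x\<close> is 0 exactly when that of x is at most
      1/2, so the common kernel makes f and g take the same branch of the doubling.\<close>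
    have half: "f x \<le> 1/2 \<longleftrightarrow> g x \<le> 1/2"
      using ker[OF tt(1)] x by (auto simp: hom max_def split: if_splits)
    show ?case
    proof (cases "f x \<le> 1/2")
      case True
      then have "f (x \<oplus> x) = 2 * f x" "g (x \<oplus> x) = 2 * g x" using half x by (simp_all add: hom)
      then show ?thesis using Suc.IH[OF tt(2)] by (simp add: abs_if split: if_splits)
    next
      case False
      then have "f (x \<odot> x) = 2 * f x - 1" "g (x \<odot> x) = 2 * g x - 1" using half x by (simp_all add: hom)
      then show ?thesis using Suc.IH[OF tt(1)] by (simp add: abs_if split: if_splits)
    qed
  qed
  from this[OF x] have "\<bar>f x - g x\<bar> \<le> 0"
    by (intro LIMSEQ_le_const[OF LIMSEQ_power_zero[of "1/2::real"]]) auto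
  then show ?thesis by simp
qed

lemma unit_hom_unique:
  assumes f: "f \<in> mv_hom A unit_interval" and g: "g \<in> mv_hom A unit_interval"
    and ker: "\<And>x. x \<in> carrier A \<Longrightarrow> f x = 0 \<longleftrightarrow> g x = 0"
  shows "f = g"
proof (rule extensionalityI)
  show "f \<in> extensional (carrier A)" "g \<in> extensional (carrier A)"
    using f g by (auto simp: mv_hom_def PiE_def)
qed (rule unit_hom_eqI_ker[OF f g ker])

lemma unit_hom_inj:
  assumes f: "f \<in> mv_hom A unit_interval"
    and ker: "\<And>x. x \<in> carrier A \<Longrightarrow> f x = 0 \<Longrightarrow> x = \<zero>"
  shows "inj_on f (carrier A)"
proof (rule inj_onI)
  fix x y assume c: "x \<in> carrier A" "y \<in> carrier A" and "f x = f y"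
  then have "x \<ominus> y = \<zero>" "y \<ominus> x = \<zero>" using ker by (simp_all add: unit_hom_diff[OF f])
  then show "x = y" using diff_eq_zero_iff le_antisym c by simp
qed

end

text \<open>This justifies the description operator in \<open>mv_emb\<close>. The value map is
  injective because a nonzero element has a multiple equal to \<one>, which is impossible at value
  0; any two embeddings agree because both have kernel zero.\<close>

lemma (in simple_mv_algebra) ex1_unit_hom:
  "\<exists>!h. h \<in> mv_hom A unit_interval \<and> inj_on h (carrier A)"
proof (rule ex_ex1I)
  have "x = \<zero>" if x: "x \<in> carrier A" "restrict val (carrier A) x = 0" for x
  proof (rule ccontr)
    assume "x \<noteq> \<zero>"
    then obtain n where "nsum n x = \<one>" using archimedean[OF x(1)] by blast
    then show False
      using unit_hom_nsum[OF val_hom x(1), of n] unit_hom_one[OF val_hom] x(2) by simp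
  qed
  then show "\<exists>h. h \<in> mv_hom A unit_interval \<and> inj_on h (carrier A)"
    using val_hom unit_hom_inj by blast
next
  fix f g
  assume f: "f \<in> mv_hom A unit_interval \<and> inj_on f (carrier A)"
    and g: "g \<in> mv_hom A unit_interval \<and> inj_on g (carrier A)"
  have "h x = 0 \<longleftrightarrow> x = \<zero>"
    if "h \<in> mv_hom A unit_interval \<and> inj_on h (carrier A)" "x \<in> carrier A" for h x
    using that inj_on_eq_iff[of h "carrier A" x \<zero>] unit_hom_zero[of h] by auto
  then show "f = g" using f g by (intro unit_hom_unique) auto
qed

section \<open>Values of the representation at a maximal ideal\<close>

context mv_algebra
begin

text \<open>The values at M are those of the homomorphism to [0,1] with kernel M. From here on the
  quotient is not inspected again.\<close>

lemma
  assumes M: "M \<in> max_ideals A"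
  shows hat_hom: "(\<lambda>a\<in>carrier A. hat A a M) \<in> mv_hom A unit_interval"
    and hat_eq_zero_iff: "a \<in> carrier A \<Longrightarrow> hat A a M = 0 \<longleftrightarrow> a \<in> M"
proof -
  interpret Q: simple_mv_algebra "mv_quot A M" by (rule simple_quot[OF M])
  note I = max_ideal_ideal[OF M]
  define e where "e = mv_emb A M"
  have e: "e \<in> mv_hom (mv_quot A M) unit_interval" "inj_on e (carrier (mv_quot A M))"
    using theI'[OF Q.ex1_unit_hom] by (simp_all add: e_def mv_emb_def)
  have hat: "hat A a M = e (cls M a)" for a using M by (simp add: hat_def e_def)
  have cl: "cls M a \<in> carrier (mv_quot A M)" if "a \<in> carrier A" for a
    using that by (simp add: quot_carrier)
  show "(\<lambda>a\<in>carrier A. hat A a M) \<in> mv_hom A unit_interval"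
    using Q.unit_hom_bounds[OF e(1) cl] Q.unit_hom_plus[OF e(1) cl cl] Q.unit_hom_neg[OF e(1) cl]
      Q.unit_hom_zero[OF e(1)]
    by (auto simp: mv_hom_def unit_interval_def hat quot_plus[OF I] quot_neg[OF I] quot_zero)
  show "hat A a M = 0 \<longleftrightarrow> a \<in> M" if "a \<in> carrier A"
    using inj_on_eq_iff[OF e(2) cl[OF that] cl[OF zero_closed]] Q.unit_hom_zero[OF e(1)]
      cls_eq_zero_iff[OF I that] by (simp add: hat quot_zero)
qed

text \<open>The other half of the bijection: every homomorphism to [0,1] is evaluation at its own
  kernel. Preimages of maximal ideals and kernels of point evaluations are computed through
  this.\<close>

lemma hat_ker:
  assumes "\<psi> \<in> mv_hom A unit_interval" "a \<in> carrier A"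
  shows "hat A a {x \<in> carrier A. \<psi> x = 0} = \<psi> a"
proof -
  note M = unit_hom_max_ideal[OF assms(1)]
  have "(\<lambda>a\<in>carrier A. hat A a {x \<in> carrier A. \<psi> x = 0}) = \<psi>"
    by (rule unit_hom_unique[OF hat_hom[OF M] assms(1)]) (simp add: hat_eq_zero_iff[OF M])
  from fun_cong[OF this, of a] show ?thesis using assms(2) by simp
qed

lemma
  assumes M: "M \<in> max_ideals A" and x: "x \<in> carrier A"
  shows hat_nonneg: "0 \<le> hat A x M" and hat_le_1: "hat A x M \<le> 1"
  using unit_hom_bounds[OF hat_hom[OF M] x] x by simp_all

lemma hat_neg: "M \<in> max_ideals A \<Longrightarrow> x \<in> carrier A \<Longrightarrow> hat A (\<sim> x) M = 1 - hat A x M"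
  using unit_hom_neg[OF hat_hom, of M x] by simp

lemma hat_nsum:
  "M \<in> max_ideals A \<Longrightarrow> x \<in> carrier A \<Longrightarrow> hat A (nsum n x) M = min 1 (real n * hat A x M)"
  using unit_hom_nsum[OF hat_hom, of M x n] by simp

lemma
  assumes "M \<in> max_ideals A" "x \<in> carrier A" "y \<in> carrier A"
  shows hat_plus: "hat A (x \<oplus> y) M = min 1 (hat A x M + hat A y M)"
    and hat_times: "hat A (x \<odot> y) M = max 0 (hat A x M + hat A y M - 1)"
    and hat_diff: "hat A (x \<ominus> y) M = max 0 (hat A x M - hat A y M)"
    and hat_mono: "x \<preceq> y \<Longrightarrow> hat A x M \<le> hat A y M"
  using unit_hom_plus[OF hat_hom, of M x y] unit_hom_times[OF hat_hom, of M x y]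
    unit_hom_diff[OF hat_hom, of M x y] unit_hom_mono[OF hat_hom, of M x y] assms by simp_all

lemma
  assumes "M \<in> max_ideals A"
  shows hat_zero: "hat A \<zero> M = 0" and hat_one: "hat A \<one> M = 1"
  using unit_hom_zero[OF hat_hom] unit_hom_one[OF hat_hom] assms by simp_all

lemma hat_closed: "x \<in> carrier A \<Longrightarrow> hat A x \<in> carrier (fuzzy (max_ideals A))"
  using hat_nonneg hat_le_1 by (auto simp: fuzzy_def hat_def)

text \<open>Properness is put as \<one> \<notin> J, a condition inherited by unions of
  chains.\<close>

lemma ideal_Zorn:
  assumes I: "mv_ideal A I" "\<one> \<notin> I"
  obtains M where "M \<in> max_ideals A" "I \<subseteq> M"
proof -
  let ?P = "{J. mv_ideal A J \<and> \<one> \<notin> J \<and> I \<subseteq> J}"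
  have "\<exists>M\<in>?P. \<forall>J\<in>?P. M \<subseteq> J \<longrightarrow> J = M"
  proof (rule subset_Zorn_nonempty)
    show "?P \<noteq> {}" using I by blast
    fix \<C> assume ne: "\<C> \<noteq> {}" and ch: "subset.chain ?P \<C>"
    have P: "J \<in> ?P" if "J \<in> \<C>" for J using ch that by (auto simp: subset_chain_def)
    have "mv_ideal A (\<Union>\<C>)"
      unfolding mv_ideal_def
    proof (intro conjI ballI impI)
      show "\<Union>\<C> \<subseteq> carrier A" using P ideal_carrier by blast
      show "\<zero> \<in> \<Union>\<C>" using ne P ideal_zero by blast
    next
      fix x y assume "x \<in> \<Union>\<C>" "y \<in> \<Union>\<C>"
      then obtain J K where "J \<in> \<C>" "K \<in> \<C>" "x \<in> J" "y \<in> K" by blast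
      moreover from this have "J \<subseteq> K \<or> K \<subseteq> J" using ch by (auto simp: subset_chain_def)
      ultimately show "x \<oplus> y \<in> \<Union>\<C>" using P ideal_plus by blast
    next
      fix x y assume "x \<in> carrier A" "y \<in> \<Union>\<C>" "x \<preceq> y"
      then show "x \<in> \<Union>\<C>" using P ideal_down by blast
    qed
    then show "\<Union>\<C> \<in> ?P" using P ne by blast
  qed
  then obtain M where M: "M \<in> ?P" "\<forall>J\<in>?P. M \<subseteq> J \<longrightarrow> J = M" by (rule bexE)
  have "M \<in> max_ideals A"
    unfolding max_ideals_def
  proof (intro CollectI conjI allI impI)
    fix J assume J: "mv_ideal A J \<and> M \<subseteq> J"
    then have "J \<in> ?P" if "\<one> \<notin> J" using M(1) that by blast
    then show "J = M \<or> J = carrier A" using J M(2) ideal_one[of J] by blast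
  qed (use M(1) one_closed in auto)
  then show ?thesis using that M(1) by blast
qed

end

lemma mv_hom_compose:
  assumes A: "mv_algebra A" and h: "h \<in> mv_hom A B" and k: "k \<in> mv_hom B C"
  shows "compose (carrier A) k h \<in> mv_hom A C"
proof -
  interpret mv_algebra A by (rule A)
  have "h x \<in> carrier B" if "x \<in> carrier A" for x using h that by (auto simp: mv_hom_def)
  then show ?thesis using h k by (auto simp: mv_hom_def compose_def Pi_iff)
qed

section \<open>Joins of fuzzy sets\<close>

lemma fuzzy_carrier_iff:
  "\<alpha> \<in> carrier (fuzzy X) \<longleftrightarrow> \<alpha> \<in> extensional X \<and> (\<forall>x\<in>X. 0 \<le> \<alpha> x \<and> \<alpha> x \<le> 1)"
  by (auto simp: fuzzy_def PiE_def Pi_iff)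

lemma fuzzy_eqI:
  "\<alpha> \<in> carrier (fuzzy X) \<Longrightarrow> \<beta> \<in> carrier (fuzzy X) \<Longrightarrow> (\<And>x. x \<in> X \<Longrightarrow> \<alpha> x = \<beta> x) \<Longrightarrow> \<alpha> = \<beta>"
  by (rule extensionalityI) (auto simp: fuzzy_carrier_iff)

lemma fuzzy_apply [simp]:
  assumes "x \<in> X"
  shows "(\<alpha> \<oplus>\<^bsub>fuzzy X\<^esub> \<beta>) x = min 1 (\<alpha> x + \<beta> x)"
    and "(\<sim>\<^bsub>fuzzy X\<^esub> \<alpha>) x = 1 - \<alpha> x"
    and "(\<alpha> \<odot>\<^bsub>fuzzy X\<^esub> \<beta>) x = max 0 (\<alpha> x + \<beta> x - 1)"
    and "fuzzy_min X \<alpha> \<beta> x = min (\<alpha> x) (\<beta> x)"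
    and "\<zero>\<^bsub>fuzzy X\<^esub> x = 0"
    and "\<one>\<^bsub>fuzzy X\<^esub> x = 1"
  using assms by (simp_all add: fuzzy_times fuzzy_one) (simp_all add: fuzzy_def fuzzy_min_def)

lemma fuzzy_plus_closed:
    "\<alpha> \<in> carrier (fuzzy X) \<Longrightarrow> \<beta> \<in> carrier (fuzzy X) \<Longrightarrow> \<alpha> \<oplus>\<^bsub>fuzzy X\<^esub> \<beta> \<in> carrier (fuzzy X)"
  and fuzzy_neg_closed: "\<alpha> \<in> carrier (fuzzy X) \<Longrightarrow> \<sim>\<^bsub>fuzzy X\<^esub> \<alpha> \<in> carrier (fuzzy X)"
  and fuzzy_min_closed:
    "\<alpha> \<in> carrier (fuzzy X) \<Longrightarrow> \<beta> \<in> carrier (fuzzy X) \<Longrightarrow> fuzzy_min X \<alpha> \<beta> \<in> carrier (fuzzy X)"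
  and fuzzy_zero_closed: "\<zero>\<^bsub>fuzzy X\<^esub> \<in> carrier (fuzzy X)"
  by (auto simp: fuzzy_carrier_iff add_nonneg_nonneg min.coboundedI1)
    (auto simp: fuzzy_def fuzzy_min_def)

lemma fuzzy_times_closed:
    "\<alpha> \<in> carrier (fuzzy X) \<Longrightarrow> \<beta> \<in> carrier (fuzzy X) \<Longrightarrow> \<alpha> \<odot>\<^bsub>fuzzy X\<^esub> \<beta> \<in> carrier (fuzzy X)"
  and fuzzy_one_closed: "\<one>\<^bsub>fuzzy X\<^esub> \<in> carrier (fuzzy X)"
  by (simp_all add: mv_times_def mv_one_def fuzzy_plus_closed fuzzy_neg_closed fuzzy_zero_closed)

lemmas fuzzy_closed = fuzzy_plus_closed fuzzy_neg_closed fuzzy_times_closed fuzzy_min_closed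
  fuzzy_zero_closed fuzzy_one_closed

context
  fixes X :: "'x set" and \<Gamma> :: "('x \<Rightarrow> real) set"
  assumes \<Gamma>: "\<Gamma> \<subseteq> carrier (fuzzy X)"
begin

lemma bdd_above_evals: "x \<in> X \<Longrightarrow> bdd_above (insert 0 ((\<lambda>\<alpha>. \<alpha> x) ` \<Gamma>))"
  using \<Gamma> by (intro bdd_aboveI[of _ 1]) (auto simp: fuzzy_carrier_iff)

lemma fuzzy_Join_upper: "\<alpha> \<in> \<Gamma> \<Longrightarrow> x \<in> X \<Longrightarrow> \<alpha> x \<le> fuzzy_Join X \<Gamma> x"
  using bdd_above_evals by (auto simp: fuzzy_Join_def intro: cSup_upper)

lemma fuzzy_Join_least:
  "x \<in> X \<Longrightarrow> 0 \<le> c \<Longrightarrow> (\<And>\<alpha>. \<alpha> \<in> \<Gamma> \<Longrightarrow> \<alpha> x \<le> c) \<Longrightarrow> fuzzy_Join X \<Gamma> x \<le> c"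
  by (auto simp: fuzzy_Join_def intro!: cSup_least)

lemma fuzzy_Join_less:
  assumes "x \<in> X" "r < fuzzy_Join X \<Gamma> x" "0 \<le> r"
  obtains \<alpha> where "\<alpha> \<in> \<Gamma>" "r < \<alpha> x"
  using fuzzy_Join_least[of x r] assms by force

lemma fuzzy_Join_closed: "fuzzy_Join X \<Gamma> \<in> carrier (fuzzy X)"
proof -
  have "0 \<le> fuzzy_Join X \<Gamma> x" if "x \<in> X" for x
    using cSup_upper[OF _ bdd_above_evals[OF that]] that by (simp add: fuzzy_Join_def)
  moreover have "fuzzy_Join X \<Gamma> x \<le> 1" if "x \<in> X" for x
    using \<Gamma> that by (intro fuzzy_Join_least) (auto simp: fuzzy_carrier_iff)
  ultimately show ?thesis by (auto simp: fuzzy_carrier_iff fuzzy_Join_def)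
qed

end

text \<open>Both topologies in play have this form: \<Theta> is the image of \<open>hat\<close> for
  \<open>Max_space\<close>, and the set of all clopens for a Stone MV-space.\<close>

definition joins :: "'x set \<Rightarrow> ('x \<Rightarrow> real) set \<Rightarrow> ('x \<Rightarrow> real) set" where
  "joins X \<Theta> = {fuzzy_Join X \<Gamma> | \<Gamma>. \<Gamma> \<subseteq> \<Theta>}"

text \<open>A family is traded for approximation at each point by one member of \<Theta> that stays
  below \<alpha> everywhere. As the empty join is zero, negative r may find no member in the family;
  the zero function serves for them.\<close>

lemma joins_iff:
  assumes \<Theta>: "\<Theta> \<subseteq> carrier (fuzzy X)" and zero: "\<zero>\<^bsub>fuzzy X\<^esub> \<in> \<Theta>"
  shows "\<alpha> \<in> joins X \<Theta> \<longleftrightarrow> \<alpha> \<in> carrier (fuzzy X) \<and>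
    (\<forall>x\<in>X. \<forall>r<\<alpha> x. \<exists>\<theta>\<in>\<Theta>. (\<forall>y\<in>X. \<theta> y \<le> \<alpha> y) \<and> r < \<theta> x)"
proof
  assume "\<alpha> \<in> joins X \<Theta>"
  then obtain \<Gamma> where \<Gamma>: "\<Gamma> \<subseteq> \<Theta>" "\<alpha> = fuzzy_Join X \<Gamma>" by (auto simp: joins_def)
  have \<Gamma>c: "\<Gamma> \<subseteq> carrier (fuzzy X)" using \<Gamma> \<Theta> by blast
  have \<alpha>: "\<alpha> \<in> carrier (fuzzy X)" unfolding \<Gamma> by (rule fuzzy_Join_closed[OF \<Gamma>c])
  have "\<exists>\<theta>\<in>\<Theta>. (\<forall>y\<in>X. \<theta> y \<le> \<alpha> y) \<and> r < \<theta> x" if x: "x \<in> X" "r < \<alpha> x" for x r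
  proof (cases "0 \<le> r")
    case True
    then obtain \<theta> where "\<theta> \<in> \<Gamma>" "r < \<theta> x" using fuzzy_Join_less[OF \<Gamma>c] x \<Gamma>(2) by blast
    then show ?thesis using fuzzy_Join_upper[OF \<Gamma>c] \<Gamma> by blast
  next
    case False
    then show ?thesis using zero x \<alpha> by (intro bexI[OF _ zero]) (auto simp: fuzzy_carrier_iff)
  qed
  then show "\<alpha> \<in> carrier (fuzzy X) \<and>
      (\<forall>x\<in>X. \<forall>r<\<alpha> x. \<exists>\<theta>\<in>\<Theta>. (\<forall>y\<in>X. \<theta> y \<le> \<alpha> y) \<and> r < \<theta> x)"
    using \<alpha> by blast
next
  assume R: "\<alpha> \<in> carrier (fuzzy X) \<and>
      (\<forall>x\<in>X. \<forall>r<\<alpha> x. \<exists>\<theta>\<in>\<Theta>. (\<forall>y\<in>X. \<theta> y \<le> \<alpha> y) \<and> r < \<theta> x)"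
  define \<Gamma> where "\<Gamma> = {\<theta> \<in> \<Theta>. \<forall>y\<in>X. \<theta> y \<le> \<alpha> y}"
  have \<Gamma>c: "\<Gamma> \<subseteq> carrier (fuzzy X)" using \<Theta> by (auto simp: \<Gamma>_def)
  have "\<alpha> = fuzzy_Join X \<Gamma>"
  proof (rule fuzzy_eqI[OF _ fuzzy_Join_closed[OF \<Gamma>c]])
    fix x assume x: "x \<in> X"
    show "\<alpha> x = fuzzy_Join X \<Gamma> x"
    proof (rule antisym)
      show "fuzzy_Join X \<Gamma> x \<le> \<alpha> x"
        using R x by (intro fuzzy_Join_least[OF \<Gamma>c x]) (auto simp: \<Gamma>_def fuzzy_carrier_iff)
      show "\<alpha> x \<le> fuzzy_Join X \<Gamma> x"
      proof (rule ccontr)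
        assume "\<not> ?thesis"
        then have "fuzzy_Join X \<Gamma> x < \<alpha> x" by simp
        then obtain \<theta> where "\<theta> \<in> \<Gamma>" "fuzzy_Join X \<Gamma> x < \<theta> x" using R x unfolding \<Gamma>_def by blast
        then show False using fuzzy_Join_upper[OF \<Gamma>c _ x, of \<theta>] by simp
      qed
    qed
  qed (use R in simp)
  then show "\<alpha> \<in> joins X \<Theta>" by (auto simp: joins_def \<Gamma>_def)
qed

lemma joins_closed:
  assumes "\<Theta> \<subseteq> carrier (fuzzy X)" "\<alpha> \<in> joins X \<Theta>"
  shows "\<alpha> \<in> carrier (fuzzy X)"
  using assms fuzzy_Join_closed[of _ X] by (auto simp: joins_def)

lemma joins_base: "\<Theta> \<subseteq> carrier (fuzzy X) \<Longrightarrow> \<zero>\<^bsub>fuzzy X\<^esub> \<in> \<Theta> \<Longrightarrow> \<Theta> \<subseteq> joins X \<Theta>"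
  by (auto simp: joins_iff)

lemma joins_approx:
  assumes "\<Theta> \<subseteq> carrier (fuzzy X)" "\<zero>\<^bsub>fuzzy X\<^esub> \<in> \<Theta>" "\<alpha> \<in> joins X \<Theta>" "x \<in> X" "r < \<alpha> x"
  obtains \<theta> where "\<theta> \<in> \<Theta>" "\<And>y. y \<in> X \<Longrightarrow> \<theta> y \<le> \<alpha> y" "r < \<theta> x"
  using assms(3-5) joins_iff[OF assms(1,2)] that by blast

text \<open>\<open>lim\<close> is lower semicontinuity of g at nonnegative levels: r < g s t
  survives a small decrease of both arguments. Approximants of \<alpha> and \<beta> within e then
  combine to one of f \<alpha> \<beta>, and monotonicity keeps it below.\<close>

lemma joins_op:
  assumes \<Theta>: "\<Theta> \<subseteq> carrier (fuzzy X)" "\<zero>\<^bsub>fuzzy X\<^esub> \<in> \<Theta>"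
    and f: "\<And>\<theta> \<theta>'. \<theta> \<in> \<Theta> \<Longrightarrow> \<theta>' \<in> \<Theta> \<Longrightarrow> f \<theta> \<theta>' \<in> \<Theta>"
    and closed: "\<And>\<theta> \<theta>'. \<theta> \<in> carrier (fuzzy X) \<Longrightarrow> \<theta>' \<in> carrier (fuzzy X) \<Longrightarrow> f \<theta> \<theta>' \<in> carrier (fuzzy X)"
    and g: "\<And>\<theta> \<theta>' x. x \<in> X \<Longrightarrow> f \<theta> \<theta>' x = g (\<theta> x) (\<theta>' x)"
    and mono: "\<And>s t s' t'. s \<le> s' \<Longrightarrow> t \<le> t' \<Longrightarrow> g s t \<le> g s' t'"
    and lim: "\<And>r s t. r < g s t \<Longrightarrow> r < 0 \<or> (\<exists>e>0. \<forall>s'>s-e. \<forall>t'>t-e. r < g s' t')"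
    and \<alpha>: "\<alpha> \<in> joins X \<Theta>" "\<beta> \<in> joins X \<Theta>"
  shows "f \<alpha> \<beta> \<in> joins X \<Theta>"
  unfolding joins_iff[OF \<Theta>]
proof (intro conjI ballI allI impI)
  note c = joins_closed[OF \<Theta>(1) \<alpha>(1)] joins_closed[OF \<Theta>(1) \<alpha>(2)]
  show fc: "f \<alpha> \<beta> \<in> carrier (fuzzy X)" by (rule closed[OF c])
  fix x r assume x: "x \<in> X" and r: "r < f \<alpha> \<beta> x"
  show "\<exists>\<theta>\<in>\<Theta>. (\<forall>y\<in>X. \<theta> y \<le> f \<alpha> \<beta> y) \<and> r < \<theta> x"
  proof (cases "r < 0")
    case True
    then show ?thesis using fc x by (intro bexI[OF _ \<Theta>(2)]) (auto simp: fuzzy_carrier_iff)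
  next
    case False
    then obtain e where e: "e > 0" "\<forall>s'>\<alpha> x-e. \<forall>t'>\<beta> x-e. r < g s' t'"
      using lim[of r "\<alpha> x" "\<beta> x"] r g[OF x] by auto
    have "\<alpha> x - e < \<alpha> x" "\<beta> x - e < \<beta> x" using e by simp_all
    obtain \<theta> where \<theta>: "\<theta> \<in> \<Theta>" "\<And>y. y \<in> X \<Longrightarrow> \<theta> y \<le> \<alpha> y" "\<alpha> x - e < \<theta> x"
      using joins_approx[OF \<Theta> \<alpha>(1) x \<open>\<alpha> x - e < \<alpha> x\<close>] by blast
    obtain \<eta> where \<eta>: "\<eta> \<in> \<Theta>" "\<And>y. y \<in> X \<Longrightarrow> \<eta> y \<le> \<beta> y" "\<beta> x - e < \<eta> x"
      using joins_approx[OF \<Theta> \<alpha>(2) x \<open>\<beta> x - e < \<beta> x\<close>] by blast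
    show ?thesis
      using \<theta> \<eta> e by (intro bexI[OF _ f[OF \<theta>(1) \<eta>(1)]]) (auto simp: g x intro!: mono)
  qed
qed

lemma mv_topological_space_joins:
  assumes \<Theta>: "\<Theta> \<subseteq> carrier (fuzzy X)" "\<zero>\<^bsub>fuzzy X\<^esub> \<in> \<Theta>" "\<one>\<^bsub>fuzzy X\<^esub> \<in> \<Theta>"
    and op: "\<And>\<theta> \<theta>'. \<theta> \<in> \<Theta> \<Longrightarrow> \<theta>' \<in> \<Theta> \<Longrightarrow>
      \<theta> \<oplus>\<^bsub>fuzzy X\<^esub> \<theta>' \<in> \<Theta> \<and> \<theta> \<odot>\<^bsub>fuzzy X\<^esub> \<theta>' \<in> \<Theta> \<and> fuzzy_min X \<theta> \<theta>' \<in> \<Theta>"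
  shows "mv_topological_space \<lparr>carrier = X, opens = joins X \<Theta>\<rparr>"
proof -
  have Join: "fuzzy_Join X \<Gamma> \<in> joins X \<Theta>" if \<Gamma>: "\<Gamma> \<subseteq> joins X \<Theta>" for \<Gamma>
  proof -
    have \<Gamma>c: "\<Gamma> \<subseteq> carrier (fuzzy X)" using \<Gamma> joins_closed[OF \<Theta>(1)] by blast
    show ?thesis
      unfolding joins_iff[OF \<Theta>(1,2)]
    proof (intro conjI ballI allI impI)
      show J: "fuzzy_Join X \<Gamma> \<in> carrier (fuzzy X)" by (rule fuzzy_Join_closed[OF \<Gamma>c])
      fix x r assume x: "x \<in> X" and r: "r < fuzzy_Join X \<Gamma> x"
      show "\<exists>\<theta>\<in>\<Theta>. (\<forall>y\<in>X. \<theta> y \<le> fuzzy_Join X \<Gamma> y) \<and> r < \<theta> x"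
      proof (cases "r < 0")
        case True
        then show ?thesis using J x by (intro bexI[OF _ \<Theta>(2)]) (auto simp: fuzzy_carrier_iff)
      next
        case False
        then obtain \<alpha> where \<alpha>: "\<alpha> \<in> \<Gamma>" "r < \<alpha> x" using fuzzy_Join_less[OF \<Gamma>c x r] by auto
        then have "\<alpha> \<in> joins X \<Theta>" using \<Gamma> by blast
        then obtain \<theta> where "\<theta> \<in> \<Theta>" "\<And>y. y \<in> X \<Longrightarrow> \<theta> y \<le> \<alpha> y" "r < \<theta> x"
          using joins_approx[of \<Theta> X \<alpha> x r, OF \<Theta>(1,2) _ x \<alpha>(2)] by blast
        then show ?thesis using fuzzy_Join_upper[OF \<Gamma>c \<alpha>(1)] order_trans by (intro bexI[of _ \<theta>]) fast+
      qed
    qed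
  qed
  have plus: "\<alpha> \<oplus>\<^bsub>fuzzy X\<^esub> \<beta> \<in> joins X \<Theta>" if "\<alpha> \<in> joins X \<Theta>" "\<beta> \<in> joins X \<Theta>" for \<alpha> \<beta>
  proof (rule joins_op[OF \<Theta>(1,2), where f = "mv_plus (fuzzy X)" and g = "\<lambda>s t. min 1 (s + t)"])
    fix r s t :: real assume "r < min 1 (s + t)"
    then show "r < 0 \<or> (\<exists>e>0. \<forall>s'>s-e. \<forall>t'>t-e. r < min 1 (s' + t'))"
      \<comment> \<open>Each summand may lose half of the gap between r and s + t.\<close>
      by (intro disjI2 exI[of _ "(s + t - r) / 2"]) (auto simp: field_simps)
  qed (use op that in \<open>auto intro: fuzzy_closed\<close>)
  have times: "\<alpha> \<odot>\<^bsub>fuzzy X\<^esub> \<beta> \<in> joins X \<Theta>" if "\<alpha> \<in> joins X \<Theta>" "\<beta> \<in> joins X \<Theta>" for \<alpha> \<beta>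
  proof (rule joins_op[OF \<Theta>(1,2), where f = "mv_times (fuzzy X)" and g = "\<lambda>s t. max 0 (s + t - 1)"])
    fix r s t :: real assume "r < max 0 (s + t - 1)"
    then show "r < 0 \<or> (\<exists>e>0. \<forall>s'>s-e. \<forall>t'>t-e. r < max 0 (s' + t' - 1))"
      by (cases "r < 0") (auto intro!: exI[of _ "(s + t - 1 - r) / 2"] simp: field_simps less_max_iff_disj)
  qed (use op that in \<open>auto intro: fuzzy_closed\<close>)
  have min: "fuzzy_min X \<alpha> \<beta> \<in> joins X \<Theta>" if "\<alpha> \<in> joins X \<Theta>" "\<beta> \<in> joins X \<Theta>" for \<alpha> \<beta>
  proof (rule joins_op[OF \<Theta>(1,2), where f = "fuzzy_min X" and g = min])
    fix r s t :: real assume "r < min s t"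
    then show "r < 0 \<or> (\<exists>e>0. \<forall>s'>s-e. \<forall>t'>t-e. r < min s' t')"
      by (intro disjI2 exI[of _ "min s t - r"]) auto
  qed (use op that in \<open>auto intro: fuzzy_closed\<close>)
  show ?thesis
    using joins_base[OF \<Theta>(1,2)] \<Theta> joins_closed[OF \<Theta>(1)] Join plus times min
    by (auto simp: mv_topological_space_def Let_def)
qed

section \<open>The space of maximal ideals\<close>

lemma Max_space_simps [simp]:
  "carrier (Max_space A) = max_ideals A"
  "opens (Max_space A) = joins (max_ideals A) (hat A ` carrier A)"
  by (simp_all add: Max_space_def joins_def)

context mv_algebra
begin

abbreviation X where "X \<equiv> max_ideals A"

lemma hat_image_closed: "hat A ` carrier A \<subseteq> carrier (fuzzy X)"
  using hat_closed by blast

lemma fuzzy_hat_plus: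
  "x \<in> carrier A \<Longrightarrow> y \<in> carrier A \<Longrightarrow> hat A x \<oplus>\<^bsub>fuzzy X\<^esub> hat A y = hat A (x \<oplus> y)"
  by (rule fuzzy_eqI[of _ X]) (simp_all add: fuzzy_closed hat_closed hat_plus)

lemma fuzzy_hat_neg: "x \<in> carrier A \<Longrightarrow> \<sim>\<^bsub>fuzzy X\<^esub> hat A x = hat A (\<sim> x)"
  by (rule fuzzy_eqI[of _ X]) (simp_all add: fuzzy_closed hat_closed hat_neg)

lemma fuzzy_hat_times:
  "x \<in> carrier A \<Longrightarrow> y \<in> carrier A \<Longrightarrow> hat A x \<odot>\<^bsub>fuzzy X\<^esub> hat A y = hat A (x \<odot> y)"
  by (rule fuzzy_eqI[of _ X]) (simp_all add: fuzzy_closed hat_closed hat_times)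

lemma fuzzy_hat_min:
  "x \<in> carrier A \<Longrightarrow> y \<in> carrier A \<Longrightarrow> fuzzy_min X (hat A x) (hat A y) = hat A (x \<ominus> (x \<ominus> y))"
  by (rule fuzzy_eqI[of _ X]) (auto simp: fuzzy_closed hat_closed hat_diff hat_nonneg min_def max_def)

lemma fuzzy_hat_zero: "\<zero>\<^bsub>fuzzy X\<^esub> = hat A \<zero>"
  by (rule fuzzy_eqI[of _ X]) (simp_all add: fuzzy_closed hat_closed hat_zero)

lemma fuzzy_hat_one: "\<one>\<^bsub>fuzzy X\<^esub> = hat A \<one>"
  by (rule fuzzy_eqI[of _ X]) (simp_all add: fuzzy_closed hat_closed hat_one)

lemma zero_hat_image: "\<zero>\<^bsub>fuzzy X\<^esub> \<in> hat A ` carrier A"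
  by (simp add: fuzzy_hat_zero)

lemma mv_topological_space_Max: "mv_topological_space (Max_space A)"
proof -
  have "mv_topological_space \<lparr>carrier = X, opens = joins X (hat A ` carrier A)\<rparr>"
    by (rule mv_topological_space_joins[OF hat_image_closed zero_hat_image])
      (auto simp: fuzzy_hat_one fuzzy_hat_plus fuzzy_hat_times fuzzy_hat_min)
  then show ?thesis by (simp add: Max_space_def joins_def)
qed

lemma hat_clopen: "x \<in> carrier A \<Longrightarrow> hat A x \<in> clopens (Max_space A)"
proof -
  assume x: "x \<in> carrier A"
  have "hat A x = \<sim>\<^bsub>fuzzy X\<^esub> hat A (\<sim> x)" using x by (simp add: fuzzy_hat_neg)
  moreover have "hat A y \<in> opens (Max_space A)" if "y \<in> carrier A" for y
    using joins_base[OF hat_image_closed zero_hat_image] that by auto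
  ultimately show ?thesis using x unfolding clopens_def closeds_def Max_space_simps by blast
qed

lemma zero_dimensional_Max: "mv_zero_dimensional (Max_space A)"
  unfolding mv_zero_dimensional_def mv_base_def
  using hat_clopen joins_base[OF hat_image_closed zero_hat_image]
  by (intro exI[of _ "hat A ` carrier A"]) (auto simp: joins_def)

text \<open>Distinct maximal ideals are incomparable, so some a lies in M but not in N; a large
  multiple of a reaches 1 at N and stays 0 at M.\<close>

lemma max_ideals_separated:
  assumes "M \<in> X" "N \<in> X" "M \<noteq> N"
  obtains b where "b \<in> carrier A" "hat A b M = 0" "hat A b N = 1"
proof -
  have "\<not> M \<subseteq> N"
    using assms max_ideal_eqI[of M N] max_ideal_ideal[of N] max_ideal_one[of N] one_closed by blast
  then obtain a where a: "a \<in> M" "a \<notin> N" by blast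
  have ac: "a \<in> carrier A" using a(1) ideal_carrier max_ideal_ideal assms(1) by blast
  have "0 < hat A a N" using hat_eq_zero_iff[OF assms(2) ac] a hat_nonneg[OF assms(2) ac] by simp
  then obtain n where "1 < real n * hat A a N" using ex_less_of_nat_mult by blast
  moreover have "hat A a M = 0" using hat_eq_zero_iff[OF assms(1) ac] a by simp
  ultimately show ?thesis using that[of "nsum n a"] assms ac by (simp add: hat_nsum)
qed

lemma Hausdorff_Max: "mv_Hausdorff (Max_space A)"
  unfolding mv_Hausdorff_def Max_space_simps
proof (intro ballI impI)
  fix M N assume MN: "M \<in> X" "N \<in> X" "M \<noteq> N"
  then obtain b where b: "b \<in> carrier A" "hat A b M = 0" "hat A b N = 1"
    using max_ideals_separated by blast
  \<comment> \<open>Pointwise these are max 0 (1 - 2b) and max 0 (2b - 1), of which at most one is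
    positive.\<close>
  let ?\<alpha> = "hat A (\<sim> b \<odot> \<sim> b)" and ?\<beta> = "hat A (b \<odot> b)"
  have "fuzzy_min X ?\<alpha> ?\<beta> = \<zero>\<^bsub>fuzzy X\<^esub>"
    using b(1) by (intro fuzzy_eqI[of _ X])
      (auto simp: fuzzy_closed hat_closed hat_times hat_neg min_def max_def)
  moreover have "?\<alpha> M = 1" "?\<beta> N = 1" using b MN by (simp_all add: hat_times hat_neg)
  moreover have "?\<alpha> \<in> joins X (hat A ` carrier A)" "?\<beta> \<in> joins X (hat A ` carrier A)"
    using joins_base[OF hat_image_closed zero_hat_image] b(1) by auto
  ultimately show "\<exists>\<alpha>\<in>joins X (hat A ` carrier A). \<exists>\<beta>\<in>joins X (hat A ` carrier A).
      \<alpha> M = 1 \<and> \<beta> N = 1 \<and> fuzzy_min X \<alpha> \<beta> = \<zero>\<^bsub>fuzzy X\<^esub>" by blast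
qed

section \<open>Finite sums and compactness\<close>

abbreviation lsum where "lsum as \<equiv> foldr (\<oplus>) as \<zero>"

lemma lsum_closed: "set as \<subseteq> carrier A \<Longrightarrow> lsum as \<in> carrier A"
  by (induction as) auto

lemma lsum_append:
  "set as \<subseteq> carrier A \<Longrightarrow> set bs \<subseteq> carrier A \<Longrightarrow> lsum (as @ bs) = lsum as \<oplus> lsum bs"
  by (induction as) (auto simp: lsum_closed plus_assoc)

lemma ideal_generated:
  assumes G: "G \<subseteq> carrier A"
  shows "mv_ideal A {x \<in> carrier A. \<exists>as. set as \<subseteq> G \<and> x \<preceq> lsum as}" (is "mv_ideal A ?I")
  unfolding mv_ideal_def
proof (intro conjI ballI impI)
  show "?I \<subseteq> carrier A" by blast
next
  have "\<zero> \<preceq> lsum []" by simp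
  then show "\<zero> \<in> ?I" by (intro CollectI conjI exI[of _ "[]"]) simp_all
next
  fix x y assume "x \<in> ?I" "y \<in> ?I"
  then obtain as bs where *: "set as \<subseteq> G" "x \<preceq> lsum as" "set bs \<subseteq> G" "y \<preceq> lsum bs"
    "x \<in> carrier A" "y \<in> carrier A" by auto
  have "set as \<subseteq> carrier A" "set bs \<subseteq> carrier A" using * G by auto
  then have "x \<oplus> y \<preceq> lsum (as @ bs)"
    unfolding lsum_append[OF \<open>set as \<subseteq> carrier A\<close> \<open>set bs \<subseteq> carrier A\<close>]
    by (intro plus_mono[OF *(2,4)] * lsum_closed)
  moreover have "set (as @ bs) \<subseteq> G" using * by simp
  moreover have "x \<oplus> y \<in> carrier A" using * by simp
  ultimately show "x \<oplus> y \<in> ?I" by (intro CollectI conjI exI)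
next
  fix x y assume *: "x \<in> carrier A" "y \<in> ?I" "x \<preceq> y"
  then obtain as where as: "set as \<subseteq> G" "y \<preceq> lsum as" by auto
  then have "x \<preceq> lsum as" using le_trans[of x y "lsum as"] lsum_closed * G by auto
  with as(1) *(1) show "x \<in> ?I" by (intro CollectI conjI exI)
qed

text \<open>If no finite sum of elements lying below members of the covering is \<open>\<one>\<close>, these elements
  generate a proper ideal, and the covering vanishes at any maximal ideal containing it.\<close>

lemma compact_Max: "mv_compact (Max_space A)"
  unfolding mv_compact_def Let_def Max_space_simps
proof (intro allI impI, elim conjE)
  fix \<Gamma>
  assume \<Gamma>: "\<Gamma> \<subseteq> joins X (hat A ` carrier A)" and cover: "fuzzy_Join X \<Gamma> = \<one>\<^bsub>fuzzy X\<^esub>"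
  let ?foldr = "\<lambda>\<gamma>s. foldr (mv_plus (fuzzy X)) \<gamma>s \<zero>\<^bsub>fuzzy X\<^esub>"
  have \<Gamma>c: "\<Gamma> \<subseteq> carrier (fuzzy X)" using \<Gamma> joins_closed[OF hat_image_closed] by blast
  define G where "G = {a \<in> carrier A. \<exists>\<gamma>\<in>\<Gamma>. \<forall>M\<in>X. hat A a M \<le> \<gamma> M}"
  let ?I = "{x \<in> carrier A. \<exists>as. set as \<subseteq> G \<and> x \<preceq> lsum as}"
  have Gc: "G \<subseteq> carrier A" by (auto simp: G_def)
  have "\<one> \<in> ?I"
  proof (rule ccontr)
    assume "\<one> \<notin> ?I"
    then obtain M where M: "M \<in> X" "?I \<subseteq> M" using ideal_Zorn[OF ideal_generated[OF Gc]] by blast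
    \<comment> \<open>The join is 1 at M; the threshold 1/2 yields an element of G with nonzero
      value at M, although M contains G.\<close>
    have half: "1/2 < fuzzy_Join X \<Gamma> M" using M by (simp add: cover)
    obtain \<gamma> where \<gamma>: "\<gamma> \<in> \<Gamma>" "1/2 < \<gamma> M"
      by (rule fuzzy_Join_less[OF \<Gamma>c M(1) half]) simp_all
    have "\<gamma> \<in> joins X (hat A ` carrier A)" using \<gamma> \<Gamma> by blast
    from joins_approx[OF hat_image_closed zero_hat_image this M(1) \<gamma>(2)]
    obtain a where a: "a \<in> carrier A" "\<And>N. N \<in> X \<Longrightarrow> hat A a N \<le> \<gamma> N" "1/2 < hat A a M"
      by blast
    have "a \<in> G" using a \<gamma>(1) by (auto simp: G_def)
    moreover have "a \<preceq> lsum [a]" using a(1) by simp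
    ultimately have "a \<in> ?I" using a(1) by (intro CollectI conjI exI[of _ "[a]"]) simp_all
    then have "a \<in> M" by (rule subsetD[OF M(2)])
    then have "hat A a M = 0" using hat_eq_zero_iff[OF M(1) a(1)] by simp
    then show False using a(3) by simp
  qed
  then obtain as where as: "set as \<subseteq> G" "\<one> \<preceq> lsum as" by blast
  then have one: "lsum as = \<one>" using one_le_iff lsum_closed Gc by blast
  \<comment> \<open>Each summand is replaced by a member of the covering above its hat; the fuzzy
    sum can only grow.\<close>
  have "\<exists>\<gamma>s. set \<gamma>s \<subseteq> \<Gamma> \<and> ?foldr \<gamma>s \<in> carrier (fuzzy X) \<and> (\<forall>M\<in>X. hat A (lsum as) M \<le> ?foldr \<gamma>s M)"
    using as(1)
  proof (induction as)
    case Nil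
    then show ?case by (intro exI[of _ "[]"]) (simp add: hat_zero fuzzy_closed)
  next
    case (Cons a as)
    then obtain \<gamma>s where \<gamma>s: "set \<gamma>s \<subseteq> \<Gamma>" "?foldr \<gamma>s \<in> carrier (fuzzy X)"
      "\<forall>M\<in>X. hat A (lsum as) M \<le> ?foldr \<gamma>s M" by auto
    obtain \<gamma> where \<gamma>: "\<gamma> \<in> \<Gamma>" "\<forall>M\<in>X. hat A a M \<le> \<gamma> M" using Cons.prems by (auto simp: G_def)
    have "a \<in> carrier A" "lsum as \<in> carrier A" using Cons.prems Gc lsum_closed[of as] by auto
    then have "\<forall>M\<in>X. hat A (lsum (a # as)) M \<le> ?foldr (\<gamma> # \<gamma>s) M"
      using \<gamma> \<gamma>s(3) by (auto simp: hat_plus intro!: min.coboundedI2 add_mono)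
    then show ?case using \<gamma> \<gamma>s \<Gamma>c
      by (intro exI[of _ "\<gamma> # \<gamma>s"]) (auto intro: fuzzy_closed)
  qed
  then obtain \<gamma>s where \<gamma>s: "set \<gamma>s \<subseteq> \<Gamma>" "?foldr \<gamma>s \<in> carrier (fuzzy X)" "\<forall>M\<in>X. 1 \<le> ?foldr \<gamma>s M"
    using one by (auto simp: hat_one)
  have "?foldr \<gamma>s = \<one>\<^bsub>fuzzy X\<^esub>"
    using \<gamma>s(2,3)
    by (intro fuzzy_eqI[OF \<gamma>s(2) fuzzy_closed(6)]) (auto simp: fuzzy_carrier_iff intro: antisym)
  then show "\<exists>\<alpha>s. set \<alpha>s \<subseteq> \<Gamma> \<and> ?foldr \<alpha>s = \<one>\<^bsub>fuzzy X\<^esub>" using \<gamma>s(1) by blast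
qed

lemma stone_Max: "stone_mv_space (Max_space A)"
  by (simp add: stone_mv_space_def mv_topological_space_Max compact_Max Hausdorff_Max
      zero_dimensional_Max)

end

text \<open>Composition with f is pointwise and so commutes with joins; continuity has to be checked
  only on generators.\<close>

lemma joins_compose:
  assumes f: "f \<in> X \<rightarrow> Y" and base: "\<And>\<theta>. \<theta> \<in> \<Theta>' \<Longrightarrow> compose X \<theta> f \<in> \<Theta>" and \<alpha>: "\<alpha> \<in> joins Y \<Theta>'"
  shows "compose X \<alpha> f \<in> joins X \<Theta>"
proof -
  obtain \<Gamma> where \<Gamma>: "\<Gamma> \<subseteq> \<Theta>'" "\<alpha> = fuzzy_Join Y \<Gamma>" using \<alpha> by (auto simp: joins_def)
  have "compose X (fuzzy_Join Y \<Gamma>) f = fuzzy_Join X ((\<lambda>\<theta>. compose X \<theta> f) ` \<Gamma>)"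
    using f by (auto simp: fuzzy_Join_def compose_def image_image fun_eq_iff Pi_iff)
  then show ?thesis using \<Gamma> base by (auto simp: joins_def)
qed

text \<open>The preimage of N is the kernel of h followed by evaluation at N, a homomorphism to
  [0,1]. Its maximality and the values of \<open>hat\<close> there are instances of the facts about
  such kernels.\<close>

lemma
  assumes "mv_algebra A" "mv_algebra B" and h: "h \<in> mv_hom A B" and N: "N \<in> max_ideals B"
  shows Max_map_max_ideal: "Max_map A B h N \<in> max_ideals A"
    and hat_Max_map: "a \<in> carrier A \<Longrightarrow> hat A a (Max_map A B h N) = hat B (h a) N"
proof -
  interpret A: mv_algebra A by fact
  interpret B: mv_algebra B by fact
  let ?\<psi> = "compose (carrier A) (\<lambda>b\<in>carrier B. hat B b N) h"
  have hB: "h a \<in> carrier B" if "a \<in> carrier A" for a using h that by (auto simp: mv_hom_def)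
  have \<psi>: "?\<psi> \<in> mv_hom A unit_interval"
    by (rule mv_hom_compose[OF assms(1) h B.hat_hom[OF N]])
  have eq: "Max_map A B h N = {a \<in> carrier A. ?\<psi> a = 0}"
    using N hB B.hat_eq_zero_iff[OF N] by (auto simp: Max_map_def compose_def)
  show "Max_map A B h N \<in> max_ideals A" unfolding eq by (rule A.unit_hom_max_ideal[OF \<psi>])
  show "hat A a (Max_map A B h N) = hat B (h a) N" if "a \<in> carrier A"
    using A.hat_ker[OF \<psi> that] that hB by (simp add: eq compose_def)
qed

text \<open>Pulling back along \<open>Max_map\<close> takes hats to hats, which gives both the
  continuity of \<open>Max_map\<close> and the naturality of \<open>hat_map\<close>.\<close>

lemma compose_hat_Max_map:
  assumes A: "mv_algebra A" and B: "mv_algebra B" and h: "h \<in> mv_hom A B" and a: "a \<in> carrier A"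
  shows "compose (max_ideals B) (hat A a) (Max_map A B h) = hat B (h a)"
  using hat_Max_map[OF A B h _ a] by (auto simp: compose_def fun_eq_iff) (simp add: hat_def)

lemma Max_map_continuous:
  assumes A: "mv_algebra A" and B: "mv_algebra B" and h: "h \<in> mv_hom A B"
  shows "Max_map A B h \<in> mv_continuous (Max_space B) (Max_space A)"
proof -
  have map: "Max_map A B h \<in> max_ideals B \<rightarrow>\<^sub>E max_ideals A"
    using Max_map_max_ideal[OF A B h] by (auto simp: Max_map_def)
  have hB: "h a \<in> carrier B" if "a \<in> carrier A" for a using h that by (auto simp: mv_hom_def)
  have "compose (max_ideals B) \<alpha> (Max_map A B h) \<in> joins (max_ideals B) (hat B ` carrier B)"
    if "\<alpha> \<in> joins (max_ideals A) (hat A ` carrier A)" for \<alpha>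
  proof (rule joins_compose[OF _ _ that])
    show "Max_map A B h \<in> max_ideals B \<rightarrow> max_ideals A" using map by auto
  qed (use compose_hat_Max_map[OF A B h] hB in auto)
  then show ?thesis using map by (simp add: mv_continuous_def)
qed

lemma Max_map_id:
  assumes "mv_algebra A"
  shows "Max_map A A (\<lambda>a\<in>carrier A. a) = (\<lambda>M\<in>max_ideals A. M)"
  using mv_algebra.ideal_carrier[OF assms mv_algebra.max_ideal_ideal[OF assms]]
  by (auto simp: Max_map_def fun_eq_iff)

lemma Max_map_compose:
  assumes A: "mv_algebra A" and B: "mv_algebra B" and C: "mv_algebra C"
    and h: "h \<in> mv_hom A B" and k: "k \<in> mv_hom B C"
  shows "Max_map A C (compose (carrier A) k h) =
    compose (max_ideals C) (Max_map A B h) (Max_map B C k)"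
proof (rule ext)
  fix N
  have hB: "h a \<in> carrier B" if "a \<in> carrier A" for a using h that by (auto simp: mv_hom_def)
  show "Max_map A C (compose (carrier A) k h) N =
    compose (max_ideals C) (Max_map A B h) (Max_map B C k) N"
    using Max_map_max_ideal[OF B C k, of N] hB
    by (auto simp: Max_map_def compose_def)
qed

section \<open>The algebra of clopens\<close>

lemma Clop_algebra_simps [simp]:
  "carrier (Clop_algebra S) = clopens S"
  "mv_plus (Clop_algebra S) = mv_plus (fuzzy (carrier S))"
  "mv_neg (Clop_algebra S) = mv_neg (fuzzy (carrier S))"
  "mv_zero (Clop_algebra S) = mv_zero (fuzzy (carrier S))"
  "mv_one (Clop_algebra S) = mv_one (fuzzy (carrier S))"
  "mv_times (Clop_algebra S) = mv_times (fuzzy (carrier S))"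
  "mv_le (Clop_algebra S) = mv_le (fuzzy (carrier S))"
  by (simp_all add: Clop_algebra_def mv_one_def mv_times_def mv_le_def fun_eq_iff)

lemma mem_Upper_mv_order:
  "u \<in> Upper (mv_order A) Z \<longleftrightarrow> u \<in> carrier A \<and> (\<forall>z\<in>Z \<inter> carrier A. mv_le A z u)"
  by (auto simp: Upper_def mv_order_def)

lemma mem_Lower_mv_order:
  "u \<in> Lower (mv_order A) Z \<longleftrightarrow> u \<in> carrier A \<and> (\<forall>z\<in>Z \<inter> carrier A. mv_le A u z)"
  by (auto simp: Lower_def mv_order_def)

lemma least_mv_order:
  "least (mv_order A) s U \<longleftrightarrow> U \<subseteq> carrier A \<and> s \<in> U \<and> (\<forall>u\<in>U. mv_le A s u)"
  by (simp add: least_def mv_order_def)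

lemma fuzzy_neg_neg: "\<alpha> \<in> carrier (fuzzy X) \<Longrightarrow> \<sim>\<^bsub>fuzzy X\<^esub> (\<sim>\<^bsub>fuzzy X\<^esub> \<alpha>) = \<alpha>"
  by (rule fuzzy_eqI[of _ X]) (simp_all add: fuzzy_closed)

lemma (in mv_algebra) limit_cut_iff:
  "limit_cut A Z \<longleftrightarrow> cut A Z \<and>
    (\<forall>M\<in>X. \<forall>e>0. \<exists>b\<in>Upper (mv_order A) Z. \<exists>a\<in>Z. hat A b M - hat A a M < e)"
proof -
  let ?U = "Upper (mv_order A) Z"
  let ?D = "{hat A b \<odot>\<^bsub>fuzzy X\<^esub> \<sim>\<^bsub>fuzzy X\<^esub> hat A a | a b. b \<in> ?U \<and> a \<in> Z}"
  have "fuzzy_Meet X ?D = \<zero>\<^bsub>fuzzy X\<^esub> \<longleftrightarrow>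
      (\<forall>M\<in>X. \<forall>e>0. \<exists>b\<in>?U. \<exists>a\<in>Z. hat A b M - hat A a M < e)"
  proof -
    have "fuzzy_Meet X ?D M = 0 \<longleftrightarrow> (\<forall>e>0. \<exists>b\<in>?U. \<exists>a\<in>Z. hat A b M - hat A a M < e)"
      if M: "M \<in> X" for M
    proof -
      let ?E = "insert 1 ((\<lambda>\<alpha>. \<alpha> M) ` ?D)"
      have nonneg: "0 \<le> v" if "v \<in> ?E" for v using that M by auto
      have bdd: "bdd_below ?E" using nonneg by (rule bdd_belowI)
      have inf0: "0 \<le> Inf ?E" using nonneg by (intro cInf_greatest) auto
      have eq: "fuzzy_Meet X ?D M = Inf ?E" using M by (simp add: fuzzy_Meet_def)
      show ?thesis unfolding eq
      proof
        assume 0: "Inf ?E = 0"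
        show "\<forall>e>0. \<exists>b\<in>?U. \<exists>a\<in>Z. hat A b M - hat A a M < e"
        proof (intro allI impI)
          fix e :: real assume "e > 0"
          \<comment> \<open>Going below 1 as well rules out the element 1 inserted by
            \<open>fuzzy_Meet\<close>, so that v comes from some b and a.\<close>
          then have "Inf ?E < min e 1" using 0 by simp
          then have "\<exists>v\<in>?E. v < min e 1" by (rule cInf_lessD[OF insert_not_empty])
          then obtain v where v: "v \<in> ?E" "v < min e 1" by (rule bexE)
          then obtain b a where "b \<in> ?U" "a \<in> Z" "v = (hat A b \<odot>\<^bsub>fuzzy X\<^esub> \<sim>\<^bsub>fuzzy X\<^esub> hat A a) M"
            by auto
          moreover from this have "hat A b M - hat A a M < e" using v M by simp
          ultimately show "\<exists>b\<in>?U. \<exists>a\<in>Z. hat A b M - hat A a M < e" by blast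
        qed
      next
        assume R: "\<forall>e>0. \<exists>b\<in>?U. \<exists>a\<in>Z. hat A b M - hat A a M < e"
        have "Inf ?E \<le> 0 + e" if "e > 0" for e
        proof -
          obtain b a where ba: "b \<in> ?U" "a \<in> Z" "hat A b M - hat A a M < e" using R \<open>e > 0\<close> by blast
          have "(hat A b \<odot>\<^bsub>fuzzy X\<^esub> \<sim>\<^bsub>fuzzy X\<^esub> hat A a) M \<in> ?E" using ba by blast
          then have "Inf ?E \<le> (hat A b \<odot>\<^bsub>fuzzy X\<^esub> \<sim>\<^bsub>fuzzy X\<^esub> hat A a) M"
            by (rule cInf_lower[OF _ bdd])
          then show ?thesis using M ba \<open>e > 0\<close> by simp
        qed
        then show "Inf ?E = 0" using inf0 field_le_epsilon[of "Inf ?E" 0] by fastforce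
      qed
    qed
    moreover have "fuzzy_Meet X ?D = \<zero>\<^bsub>fuzzy X\<^esub> \<longleftrightarrow> (\<forall>M\<in>X. fuzzy_Meet X ?D M = 0)"
      by (auto simp: fun_eq_iff) (auto simp: fuzzy_Meet_def fuzzy_def)
    ultimately show ?thesis by simp
  qed
  then show ?thesis by (simp add: limit_cut_def Let_def)
qed

section \<open>Stone MV-spaces and evaluation at points\<close>

locale stone_space =
  fixes S :: "'x mv_space"
  assumes stone: "stone_mv_space S"
begin

abbreviation F where "F \<equiv> fuzzy (carrier S)"
abbreviation C where "C \<equiv> Clop_algebra S"

lemma
  shows opens_closed: "opens S \<subseteq> carrier F"
    and opens_zero: "\<zero>\<^bsub>F\<^esub> \<in> opens S"
    and opens_one: "\<one>\<^bsub>F\<^esub> \<in> opens S"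
    and opens_Join: "\<Gamma> \<subseteq> opens S \<Longrightarrow> fuzzy_Join (carrier S) \<Gamma> \<in> opens S"
    and opens_plus: "\<alpha> \<in> opens S \<Longrightarrow> \<beta> \<in> opens S \<Longrightarrow> \<alpha> \<oplus>\<^bsub>F\<^esub> \<beta> \<in> opens S"
    and opens_times: "\<alpha> \<in> opens S \<Longrightarrow> \<beta> \<in> opens S \<Longrightarrow> \<alpha> \<odot>\<^bsub>F\<^esub> \<beta> \<in> opens S"
  using stone by (auto simp: stone_mv_space_def mv_topological_space_def Let_def)

lemma clopens_iff: "\<alpha> \<in> clopens S \<longleftrightarrow> \<alpha> \<in> opens S \<and> \<sim>\<^bsub>F\<^esub> \<alpha> \<in> opens S"
proof -
  have "\<sim>\<^bsub>F\<^esub> (\<sim>\<^bsub>F\<^esub> \<beta>) = \<beta>" if "\<beta> \<in> opens S" for \<beta>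
    using opens_closed that fuzzy_neg_neg by blast
  then show ?thesis unfolding clopens_def closeds_def by force
qed

lemma clopens_closed: "clopens S \<subseteq> carrier F"
  using opens_closed by (auto simp: clopens_iff)

lemma clopens_neg: "\<alpha> \<in> clopens S \<Longrightarrow> \<sim>\<^bsub>F\<^esub> \<alpha> \<in> clopens S"
  using clopens_closed by (auto simp: clopens_iff fuzzy_neg_neg)

lemma clopens_zero: "\<zero>\<^bsub>F\<^esub> \<in> clopens S"
  using opens_zero opens_one by (simp add: clopens_iff mv_one_def)

text \<open>By De Morgan the complement of a sum is a product of complements, so closure of the
  opens under \<odot> enters here.\<close>

lemma clopens_plus:
  assumes "\<alpha> \<in> clopens S" "\<beta> \<in> clopens S"
  shows "\<alpha> \<oplus>\<^bsub>F\<^esub> \<beta> \<in> clopens S"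
proof -
  have c: "\<alpha> \<in> carrier F" "\<beta> \<in> carrier F" using assms clopens_closed by auto
  have "\<sim>\<^bsub>F\<^esub> (\<alpha> \<oplus>\<^bsub>F\<^esub> \<beta>) = \<sim>\<^bsub>F\<^esub> \<alpha> \<odot>\<^bsub>F\<^esub> \<sim>\<^bsub>F\<^esub> \<beta>"
    using c by (simp add: mv_times_def fuzzy_neg_neg)
  then show ?thesis using assms opens_plus opens_times by (simp add: clopens_iff)
qed

text \<open>Zero-dimensionality supplies some base of clopens; it may be enlarged to the set of all
  clopens, which is an algebra.\<close>

lemma opens_eq: "opens S = joins (carrier S) (clopens S)"
proof
  obtain \<Theta> where \<Theta>: "\<Theta> \<subseteq> clopens S" "\<forall>\<alpha>\<in>opens S. \<exists>\<Gamma>\<subseteq>\<Theta>. \<alpha> = fuzzy_Join (carrier S) \<Gamma>"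
    using stone by (auto simp: stone_mv_space_def mv_zero_dimensional_def mv_base_def)
  then show "opens S \<subseteq> joins (carrier S) (clopens S)" unfolding joins_def by blast
  show "joins (carrier S) (clopens S) \<subseteq> opens S"
    using opens_Join by (auto simp: joins_def clopens_def)
qed

lemma mv_algebra_Clop: "mv_algebra C"
proof
  note c = subsetD[OF clopens_closed]
  fix x y z assume "x \<in> carrier C" "y \<in> carrier C" "z \<in> carrier C"
  then show "x \<oplus>\<^bsub>C\<^esub> y \<oplus>\<^bsub>C\<^esub> z = x \<oplus>\<^bsub>C\<^esub> (y \<oplus>\<^bsub>C\<^esub> z)"
    using c[of x] c[of y] c[of z] by (auto intro!: fuzzy_eqI[of _ "carrier S"] simp: fuzzy_closed)
      (auto simp: fuzzy_carrier_iff min_def)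
next
  note c = subsetD[OF clopens_closed]
  fix x y assume "x \<in> carrier C" "y \<in> carrier C"
  then show "\<sim>\<^bsub>C\<^esub> (\<sim>\<^bsub>C\<^esub> x \<oplus>\<^bsub>C\<^esub> y) \<oplus>\<^bsub>C\<^esub> y = \<sim>\<^bsub>C\<^esub> (\<sim>\<^bsub>C\<^esub> y \<oplus>\<^bsub>C\<^esub> x) \<oplus>\<^bsub>C\<^esub> x"
    using c[of x] c[of y] by (auto intro!: fuzzy_eqI[of _ "carrier S"] simp: fuzzy_closed)
next
  note c = subsetD[OF clopens_closed]
  fix x y assume "x \<in> carrier C" "y \<in> carrier C"
  then show "x \<oplus>\<^bsub>C\<^esub> y = y \<oplus>\<^bsub>C\<^esub> x"
    using c[of x] c[of y] by (auto intro!: fuzzy_eqI[of _ "carrier S"] simp: fuzzy_closed add.commute)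
next
  note c = subsetD[OF clopens_closed]
  fix x assume "x \<in> carrier C"
  then show "x \<oplus>\<^bsub>C\<^esub> \<zero>\<^bsub>C\<^esub> = x" "x \<oplus>\<^bsub>C\<^esub> \<sim>\<^bsub>C\<^esub> \<zero>\<^bsub>C\<^esub> = \<sim>\<^bsub>C\<^esub> \<zero>\<^bsub>C\<^esub>"
    using c[of x] by (auto intro!: fuzzy_eqI[of _ "carrier S"] simp: fuzzy_closed)
      (auto simp: fuzzy_carrier_iff min_def)
qed (auto simp: clopens_plus clopens_neg clopens_zero subsetD[OF clopens_closed] fuzzy_neg_neg)

sublocale C: mv_algebra C by (rule mv_algebra_Clop)

context
  fixes x assumes x: "x \<in> carrier S"
begin

lemma eval_hom: "(\<lambda>\<alpha>\<in>clopens S. \<alpha> x) \<in> mv_hom C unit_interval"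
  using x clopens_closed clopens_plus clopens_neg clopens_zero
  by (auto simp: mv_hom_def unit_interval_def fuzzy_carrier_iff subset_iff)

lemma point_map_ker: "point_map S x = {\<alpha> \<in> carrier C. (\<lambda>\<alpha>\<in>clopens S. \<alpha> x) \<alpha> = 0}"
  using x by (auto simp: point_map_def)

lemma point_map_max_ideal: "point_map S x \<in> max_ideals C"
  unfolding point_map_ker by (rule C.unit_hom_max_ideal[OF eval_hom])

lemma hat_point_map: "\<alpha> \<in> clopens S \<Longrightarrow> hat C \<alpha> (point_map S x) = \<alpha> x"
  unfolding point_map_ker using C.hat_ker[OF eval_hom, of \<alpha>] by simp

end

text \<open>Hausdorff separation gives an open \<alpha> that is positive at x and zero at y;
  zero-dimensionality shrinks it to a clopen with the same two properties, which tells the kernels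
  of evaluation apart.\<close>

lemma inj_point_map: "inj_on (point_map S) (carrier S)"
proof (rule inj_onI, rule ccontr)
  fix x y assume xy: "x \<in> carrier S" "y \<in> carrier S" "point_map S x = point_map S y" "x \<noteq> y"
  then obtain \<alpha> \<beta> where \<alpha>: "\<alpha> \<in> opens S" "\<alpha> x = 1" and \<beta>: "\<beta> \<in> opens S" "\<beta> y = 1"
    and min: "fuzzy_min (carrier S) \<alpha> \<beta> = \<zero>\<^bsub>F\<^esub>"
    using stone unfolding stone_mv_space_def mv_Hausdorff_def by metis
  have "min (\<alpha> y) (\<beta> y) = 0" using fun_cong[OF min, of y] xy by simp
  then have "\<alpha> y = 0" using \<beta> by (auto simp: min_def split: if_splits)
  obtain \<theta> where \<theta>: "\<theta> \<in> clopens S" "\<And>z. z \<in> carrier S \<Longrightarrow> \<theta> z \<le> \<alpha> z" "0 < \<theta> x"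
    using joins_approx[OF clopens_closed clopens_zero, of \<alpha> x 0] \<alpha> xy unfolding opens_eq by auto
  have "\<theta> y = 0"
    using \<theta>(2)[OF xy(2)] \<open>\<alpha> y = 0\<close> clopens_closed \<theta>(1) xy(2) by (auto simp: fuzzy_carrier_iff subset_iff intro: antisym)
  then have "\<theta> \<in> point_map S y" using \<theta> xy by (simp add: point_map_def)
  then have "\<theta> \<in> point_map S x" using xy by simp
  then show False using \<theta> xy by (simp add: point_map_def)
qed

text \<open>If M were not the kernel of an evaluation, every point x would have a member of M
  nonzero at x, and a multiple of it has value 1 there. So M would be an open covering, and
  compactness would put a finite sum equal to \<one> into M.\<close>

lemma max_ideal_point:
  assumes M: "M \<in> max_ideals C"
  obtains x where "x \<in> carrier S" "point_map S x = M"
proof (rule ccontr)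
  assume no: "\<not> thesis"
  note found = that
  note I = C.max_ideal_ideal[OF M]
  have Mc: "M \<subseteq> clopens S" using I C.ideal_carrier by auto
  have Mf: "M \<subseteq> carrier F" and Mo: "M \<subseteq> opens S" using Mc clopens_closed by (auto simp: clopens_iff)
  have one: "1 \<le> fuzzy_Join (carrier S) M x" if x: "x \<in> carrier S" for x
  proof -
    note p = point_map_max_ideal[OF x]
    have "point_map S x \<noteq> M" using no found x by blast
    then have "\<not> M \<subseteq> point_map S x"
      using C.max_ideal_eqI[OF M C.max_ideal_ideal[OF p]] C.max_ideal_one[OF p] C.one_closed by metis
    then obtain \<beta> where \<beta>: "\<beta> \<in> M" "\<beta> \<notin> point_map S x" by blast
    have \<beta>c: "\<beta> \<in> clopens S" using \<beta> Mc by blast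
    then have "\<beta> x \<noteq> 0" "0 \<le> \<beta> x"
      using \<beta> x clopens_closed by (auto simp: point_map_def fuzzy_carrier_iff subset_iff)
    then obtain n where "(\<lambda>\<alpha>\<in>clopens S. \<alpha> x) (C.nsum n \<beta>) = 1"
      using C.unit_hom_nsum_one[OF eval_hom[OF x], of \<beta>] \<beta>c by auto
    then have "(C.nsum n \<beta>) x = 1" using C.nsum_closed[of \<beta> n] \<beta>c by simp
    then show ?thesis using fuzzy_Join_upper[OF Mf C.ideal_nsum[OF I \<beta>(1), of n] x] by simp
  qed
  have "fuzzy_Join (carrier S) M = \<one>\<^bsub>F\<^esub>"
    using one fuzzy_Join_closed[OF Mf]
    by (intro fuzzy_eqI[OF _ fuzzy_one_closed]) (auto simp: fuzzy_carrier_iff intro: antisym)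
  then obtain \<alpha>s where \<alpha>s: "set \<alpha>s \<subseteq> M" "foldr (mv_plus F) \<alpha>s \<zero>\<^bsub>F\<^esub> = \<one>\<^bsub>F\<^esub>"
    using stone Mo unfolding stone_mv_space_def mv_compact_def Let_def by blast
  have "foldr (mv_plus F) \<alpha>s \<zero>\<^bsub>F\<^esub> \<in> M"
    using \<alpha>s(1) C.ideal_zero[OF I] C.ideal_plus[OF I] by (induction \<alpha>s) auto
  then show False using \<alpha>s(2) C.max_ideal_one[OF M] by simp
qed

lemma bij_point_map: "bij_betw (point_map S) (carrier S) (max_ideals C)"
proof -
  have "max_ideals C \<subseteq> point_map S ` carrier S" using max_ideal_point by blast
  then show ?thesis unfolding bij_betw_def using inj_point_map point_map_max_ideal by blast
qed

text \<open>Each clopen \<alpha> corresponds to \<open>hat C \<alpha>\<close> under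
  \<open>point_map\<close> and its inverse, and these fuzzy sets generate the two
  topologies.\<close>

lemma homeo_point_map: "point_map S \<in> mv_homeo S (Max_space C)"
proof -
  let ?g = "restrict (inv_into (carrier S) (point_map S)) (max_ideals C)"
  have g: "?g M \<in> carrier S" "point_map S (?g M) = M" if "M \<in> max_ideals C" for M
    using bij_point_map that bij_betw_inv_into_right[OF bij_point_map]
      bij_betw_apply[OF bij_betw_inv_into[OF bij_point_map]] by auto
  have c1: "compose (carrier S) (hat C \<alpha>) (point_map S) = \<alpha>" if "\<alpha> \<in> clopens S" for \<alpha>
    using that clopens_closed hat_point_map
    by (auto simp: compose_def fun_eq_iff fuzzy_carrier_iff extensional_def subset_iff)
  have c2: "compose (max_ideals C) \<alpha> ?g = hat C \<alpha>" if "\<alpha> \<in> clopens S" for \<alpha>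
  proof (rule ext)
    fix M
    show "compose (max_ideals C) \<alpha> ?g M = hat C \<alpha> M"
      using that hat_point_map[OF g(1), of M \<alpha>] g(2)[of M]
      by (cases "M \<in> max_ideals C") (simp_all add: compose_def hat_def)
  qed
  have "compose (carrier S) \<alpha> (point_map S) \<in> joins (carrier S) (clopens S)"
    if "\<alpha> \<in> joins (max_ideals C) (hat C ` carrier C)" for \<alpha>
    by (rule joins_compose[OF _ _ that]) (use point_map_max_ideal c1 in auto)
  moreover have "compose (max_ideals C) \<alpha> ?g \<in> joins (max_ideals C) (hat C ` carrier C)"
    if "\<alpha> \<in> joins (carrier S) (clopens S)" for \<alpha>
    by (rule joins_compose[OF _ _ that]) (use g c2 in auto)
  moreover have "point_map S \<in> carrier S \<rightarrow>\<^sub>E max_ideals C"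
    using point_map_max_ideal by (auto simp: point_map_def)
  moreover have "?g \<in> max_ideals C \<rightarrow>\<^sub>E carrier S" using g by auto
  ultimately show ?thesis
    using bij_point_map by (simp add: mv_homeo_def mv_continuous_def opens_eq)
qed

lemma semisimple_Clop: "semisimple C"
proof -
  \<comment> \<open>The maximal ideals \<open>point_map S x\<close> by themselves already intersect
    in zero.\<close>
  have 1: "\<alpha> = \<zero>\<^bsub>F\<^esub>" if "\<alpha> \<in> clopens S" "\<forall>M\<in>max_ideals C. \<alpha> \<in> M" for \<alpha>
  proof (rule fuzzy_eqI[OF _ fuzzy_zero_closed])
    fix x assume x: "x \<in> carrier S"
    then have "\<alpha> \<in> point_map S x" using that point_map_max_ideal by blast
    then show "\<alpha> x = \<zero>\<^bsub>F\<^esub> x" using x by (simp add: point_map_def)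
  qed (use that clopens_closed in auto)
  have 2: "\<zero>\<^bsub>F\<^esub> \<in> M" if "M \<in> max_ideals C" for M
    using C.ideal_zero[OF C.max_ideal_ideal[OF that]] by simp
  have "carrier C \<inter> \<Inter> (max_ideals C) = {\<zero>\<^bsub>F\<^esub>}"
  proof (intro equalityI subsetI)
    fix \<alpha> assume "\<alpha> \<in> carrier C \<inter> \<Inter> (max_ideals C)"
    then show "\<alpha> \<in> {\<zero>\<^bsub>F\<^esub>}" using 1[of \<alpha>] by simp
  qed (use 2 clopens_zero in simp)
  then show ?thesis using mv_algebra_Clop by (simp add: semisimple_def)
qed

text \<open>The pointwise supremum of a limit cut is open; being also the pointwise infimum of the upper
  bounds, it is closed.\<close>

lemma lcc_Clop: "lcc C"
  unfolding lcc_def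
proof (intro conjI allI impI)
  show "semisimple C" by (rule semisimple_Clop)
  fix Z assume Z: "limit_cut C Z"
  let ?X = "carrier S"
  let ?U = "Upper (mv_order C) Z"
  have Zc: "Z \<subseteq> clopens S" using Z by (simp add: limit_cut_def cut_def)
  have Zf: "Z \<subseteq> carrier F" using Zc clopens_closed by blast
  have Uc: "?U \<subseteq> clopens S" by (auto simp: mem_Upper_mv_order)
  have Uf: "?U \<subseteq> carrier F" using Uc clopens_closed by blast
  have le: "mv_le F \<alpha> \<beta> \<longleftrightarrow> (\<forall>x\<in>?X. \<alpha> x \<le> \<beta> x)" if "\<alpha> \<in> clopens S" "\<beta> \<in> clopens S" for \<alpha> \<beta>
    using that clopens_closed by (intro fuzzy_le) auto
  have ZU: "a x \<le> b x" if "a \<in> Z" "b \<in> ?U" "x \<in> ?X" for a b x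
    using that Zc Uc le[of a b] by (auto simp: mem_Upper_mv_order)
  \<comment> \<open>The limit condition speaks of maximal ideals; at those of the form
    \<open>point_map S x\<close> it becomes a condition at the points of S.\<close>
  have approx: "\<exists>b\<in>?U. \<exists>a\<in>Z. b x - a x < e" if x: "x \<in> ?X" and e: "e > 0" for x e
  proof -
    obtain b a where "b \<in> ?U" "a \<in> Z" "hat C b (point_map S x) - hat C a (point_map S x) < e"
      using Z point_map_max_ideal[OF x] e unfolding C.limit_cut_iff by blast
    moreover have "b \<in> clopens S" "a \<in> clopens S" using calculation Zc Uc by auto
    ultimately show ?thesis using hat_point_map[OF x] by auto
  qed
  define s where "s = fuzzy_Join ?X Z"
  have sf: "s \<in> carrier F" unfolding s_def by (rule fuzzy_Join_closed[OF Zf])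
  have Zs: "a x \<le> s x" if "a \<in> Z" "x \<in> ?X" for a x
    unfolding s_def by (rule fuzzy_Join_upper[OF Zf that])
  have sU: "s x \<le> b x" if "b \<in> ?U" "x \<in> ?X" for b x
    unfolding s_def
  proof (rule fuzzy_Join_least[OF Zf that(2)])
    show "0 \<le> b x" using that Uf by (auto simp: fuzzy_carrier_iff subset_iff)
  qed (use ZU that in auto)
  let ?N = "mv_neg F ` ?U"
  have Nf: "?N \<subseteq> carrier F" using Uf fuzzy_neg_closed by auto
  have "\<sim>\<^bsub>F\<^esub> s = fuzzy_Join ?X ?N"
  proof (rule fuzzy_eqI[OF fuzzy_neg_closed[OF sf] fuzzy_Join_closed[OF Nf]])
    fix x assume x: "x \<in> ?X"
    show "(\<sim>\<^bsub>F\<^esub> s) x = fuzzy_Join ?X ?N x"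
    proof (rule antisym)
      show "(\<sim>\<^bsub>F\<^esub> s) x \<le> fuzzy_Join ?X ?N x"
      proof (rule field_le_epsilon)
        fix e :: real assume "e > 0"
        then obtain b a where ba: "b \<in> ?U" "a \<in> Z" "b x - a x < e" using approx x by blast
        have "(\<sim>\<^bsub>F\<^esub> b) x \<le> fuzzy_Join ?X ?N x" using ba x by (intro fuzzy_Join_upper[OF Nf]) auto
        \<comment> \<open>From a \<le> s and b - a < e at x follows 1 - s \<le> 1 - a < (1 - b) +
          e.\<close>
        then show "(\<sim>\<^bsub>F\<^esub> s) x \<le> fuzzy_Join ?X ?N x + e" using ba Zs[OF ba(2) x] x by simp
      qed
      show "fuzzy_Join ?X ?N x \<le> (\<sim>\<^bsub>F\<^esub> s) x"
        using sf sU x by (intro fuzzy_Join_least[OF Nf x]) (auto simp: fuzzy_carrier_iff)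
    qed
  qed
  moreover have "?N \<subseteq> opens S" using Uc by (auto simp: clopens_iff)
  ultimately have "\<sim>\<^bsub>F\<^esub> s \<in> opens S" using opens_Join by simp
  moreover have "s \<in> opens S" unfolding s_def using Zc by (intro opens_Join) (auto simp: clopens_iff)
  ultimately have s: "s \<in> clopens S" by (simp add: clopens_iff)
  have "s \<in> ?U" using s Zs Zc le by (auto simp: mem_Upper_mv_order)
  moreover have "mv_le F s b" if "b \<in> ?U" for b using s sU[OF that] le[OF s] Uc that by auto
  ultimately show "\<exists>s. least (mv_order C) s ?U" using Uc by (auto simp: least_mv_order)
qed

end

section \<open>The duality\<close>

lemma lcc_semisimple: "lcc A \<Longrightarrow> semisimple A"
  by (simp add: lcc_def)

lemma lcc_mv_algebra: "lcc A \<Longrightarrow> mv_algebra A"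
  by (simp add: lcc_def semisimple_def)

context mv_algebra
begin

text \<open>If the hat of x stays below that of y, then x \<ominus> y lies in every maximal ideal,
  and semisimplicity makes it zero.\<close>

lemma semisimple_le_iff:
  assumes ss: "semisimple A" and x: "x \<in> carrier A" "y \<in> carrier A"
  shows "x \<preceq> y \<longleftrightarrow> (\<forall>M\<in>X. hat A x M \<le> hat A y M)"
proof
  assume "\<forall>M\<in>X. hat A x M \<le> hat A y M"
  then have "\<forall>M\<in>X. x \<ominus> y \<in> M"
    using hat_eq_zero_iff[of _ "x \<ominus> y"] x by (simp add: hat_diff)
  then have "x \<ominus> y \<in> carrier A \<inter> \<Inter> X" using x by simp
  then have "x \<ominus> y = \<zero>" using ss unfolding semisimple_def by blast
  then show "x \<preceq> y" using diff_eq_zero_iff x by simp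
qed (use hat_mono x in blast)

lemma hat_inj:
  assumes "semisimple A"
  shows "inj_on (hat A) (carrier A)"
proof (rule inj_onI)
  fix x y assume xy: "x \<in> carrier A" "y \<in> carrier A" "hat A x = hat A y"
  then have "x \<preceq> y" "y \<preceq> x" using semisimple_le_iff[OF assms] by simp_all
  then show "x = y" using le_antisym xy by simp
qed

text \<open>The elements below a clopen form a limit cut, whose supremum represents the clopen.\<close>

lemma hat_onto:
  assumes lcc: "lcc A" and \<alpha>: "\<alpha> \<in> clopens (Max_space A)"
  obtains s where "s \<in> carrier A" "hat A s = \<alpha>"
proof -
  note le_iff = semisimple_le_iff[OF lcc_semisimple[OF lcc]]
  note joins = hat_image_closed zero_hat_image
  interpret S: stone_space "Max_space A" by unfold_locales (rule stone_Max)
  have \<alpha>o: "\<alpha> \<in> joins X (hat A ` carrier A)" "\<sim>\<^bsub>fuzzy X\<^esub> \<alpha> \<in> joins X (hat A ` carrier A)"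
    using \<alpha> unfolding S.clopens_iff by simp_all
  have \<alpha>f: "\<alpha> \<in> carrier (fuzzy X)" by (rule joins_closed[OF hat_image_closed \<alpha>o(1)])
  have below: "\<exists>a\<in>carrier A. (\<forall>N\<in>X. hat A a N \<le> \<alpha> N) \<and> r < hat A a M" if "M \<in> X" "r < \<alpha> M" for M r
    by (rule joins_approx[OF joins \<alpha>o(1) that]) auto
  \<comment> \<open>This is where closedness enters: the complement of \<alpha> is approximated from
    below.\<close>
  have above: "\<exists>b\<in>carrier A. (\<forall>N\<in>X. \<alpha> N \<le> hat A b N) \<and> hat A b M < r" if M: "M \<in> X" "\<alpha> M < r" for M r
  proof -
    have "1 - r < (\<sim>\<^bsub>fuzzy X\<^esub> \<alpha>) M" using M by simp
    from joins_approx[OF joins \<alpha>o(2) M(1) this]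
    obtain \<theta> where \<theta>: "\<theta> \<in> hat A ` carrier A" "\<And>N. N \<in> X \<Longrightarrow> \<theta> N \<le> (\<sim>\<^bsub>fuzzy X\<^esub> \<alpha>) N" "1 - r < \<theta> M"
      by blast
    from \<theta>(1) obtain a where "a \<in> carrier A" "\<theta> = hat A a" by blast
    with \<theta> have a: "a \<in> carrier A" "\<And>N. N \<in> X \<Longrightarrow> hat A a N \<le> (\<sim>\<^bsub>fuzzy X\<^esub> \<alpha>) N"
      "1 - r < hat A a M" by auto
    have "\<alpha> N \<le> hat A (\<sim> a) N" if "N \<in> X" for N using a(1) a(2)[OF that] that by (simp add: hat_neg)
    moreover have "hat A (\<sim> a) M < r" using a M by (simp add: hat_neg)
    ultimately show ?thesis using a(1) neg_closed by blast
  qed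
  define Z where "Z = {a \<in> carrier A. \<forall>M\<in>X. hat A a M \<le> \<alpha> M}"
  let ?U = "Upper (mv_order A) Z"
  \<comment> \<open>By \<open>below\<close>, \<alpha> is the pointwise supremum of the hats of Z, so
    an upper bound of Z is an element whose hat bounds \<alpha>.\<close>
  have U: "b \<in> ?U \<longleftrightarrow> b \<in> carrier A \<and> (\<forall>M\<in>X. \<alpha> M \<le> hat A b M)" for b
  proof
    assume "b \<in> ?U"
    then have b: "b \<in> carrier A" "\<forall>a\<in>Z. a \<preceq> b" by (auto simp: mem_Upper_mv_order Z_def)
    have "\<alpha> M \<le> hat A b M" if M: "M \<in> X" for M
    proof (rule ccontr)
      assume "\<not> \<alpha> M \<le> hat A b M"
      then obtain a where a: "a \<in> carrier A" "\<forall>N\<in>X. hat A a N \<le> \<alpha> N" "hat A b M < hat A a M"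
        using below[OF M, of "hat A b M"] by auto
      then have "a \<preceq> b" using b by (simp add: Z_def)
      then show False using hat_mono[OF M a(1) b(1)] a(3) by simp
    qed
    then show "b \<in> carrier A \<and> (\<forall>M\<in>X. \<alpha> M \<le> hat A b M)" using b by simp
  next
    assume b: "b \<in> carrier A \<and> (\<forall>M\<in>X. \<alpha> M \<le> hat A b M)"
    have "a \<preceq> b" if "a \<in> Z" for a
    proof -
      have "a \<in> carrier A" "\<forall>M\<in>X. hat A a M \<le> hat A b M"
        using that b unfolding Z_def by (auto intro: order_trans)
      then show ?thesis using le_iff b by simp
    qed
    then show "b \<in> ?U" using b by (simp add: mem_Upper_mv_order)
  qed
  have L: "c \<in> Z" if c: "c \<in> carrier A" "\<forall>b\<in>?U. c \<preceq> b" for c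
  proof -
    have "hat A c M \<le> \<alpha> M" if M: "M \<in> X" for M
    proof (rule ccontr)
      assume "\<not> hat A c M \<le> \<alpha> M"
      then obtain b where b: "b \<in> carrier A" "\<forall>N\<in>X. \<alpha> N \<le> hat A b N" "hat A b M < hat A c M"
        using above[OF M, of "hat A c M"] by auto
      then have "c \<preceq> b" using c U by simp
      then show False using hat_mono[OF M c(1) b(1)] b(3) by simp
    qed
    then show ?thesis using c by (simp add: Z_def)
  qed
  have "cut A Z"
    unfolding cut_def
  proof (intro conjI equalityI subsetI)
    fix c assume "c \<in> Z"
    then show "c \<in> Lower (mv_order A) ?U"
      by (auto simp: mem_Lower_mv_order mem_Upper_mv_order Z_def)
  next
    fix c assume c: "c \<in> Lower (mv_order A) ?U"
    have "b \<in> carrier A" if "b \<in> ?U" for b using that U by simp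
    then have "c \<in> carrier A" "\<forall>b\<in>?U. c \<preceq> b" using c by (auto simp: mem_Lower_mv_order)
    then show "c \<in> Z" by (rule L)
  qed (simp add: Z_def)
  moreover have "\<exists>b\<in>?U. \<exists>a\<in>Z. hat A b M - hat A a M < e" if M: "M \<in> X" and "e > 0" for M e
  proof -
    obtain a where a: "a \<in> carrier A" "\<forall>N\<in>X. hat A a N \<le> \<alpha> N" "\<alpha> M - e / 2 < hat A a M"
      using below[OF M, of "\<alpha> M - e / 2"] \<open>e > 0\<close> by auto
    obtain b where b: "b \<in> carrier A" "\<forall>N\<in>X. \<alpha> N \<le> hat A b N" "hat A b M < \<alpha> M + e / 2"
      using above[OF M, of "\<alpha> M + e / 2"] \<open>e > 0\<close> by auto
    have "a \<in> Z" "b \<in> ?U" using a b U by (simp_all add: Z_def)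
    moreover have "hat A b M - hat A a M < e" using a(3) b(3) by (simp add: field_simps)
    ultimately show ?thesis by blast
  qed
  ultimately have "limit_cut A Z" unfolding limit_cut_iff by blast
  then obtain s where s: "s \<in> ?U" "\<forall>b\<in>?U. s \<preceq> b"
    using lcc by (auto simp: lcc_def least_mv_order)
  have sc: "s \<in> carrier A" using s(1) U by simp
  \<comment> \<open>Being least, s is a lower bound of \<open>?U\<close>, hence a member of Z;
    membership in \<open>?U\<close> and in Z gives the two inequalities.\<close>
  have "s \<in> Z" using L sc s(2) by blast
  then have "hat A s = \<alpha>"
    using s(1) U by (intro fuzzy_eqI[OF hat_closed[OF sc] \<alpha>f] antisym) (auto simp: Z_def)
  then show ?thesis using that sc by blast
qed

lemma hat_map_iso:
  assumes "lcc A"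
  shows "hat_map A \<in> mv_iso A (Clop_algebra (Max_space A))"
proof -
  have "hat_map A \<in> mv_hom A (Clop_algebra (Max_space A))"
    using hat_clopen by (auto simp: mv_hom_def hat_map_def fuzzy_hat_plus fuzzy_hat_neg fuzzy_hat_zero)
  moreover have "bij_betw (hat A) (carrier A) (clopens (Max_space A))"
    unfolding bij_betw_def
  proof (intro conjI equalityI subsetI)
    show "inj_on (hat A) (carrier A)" by (rule hat_inj[OF lcc_semisimple[OF assms]])
    fix \<alpha> assume "\<alpha> \<in> clopens (Max_space A)"
    then show "\<alpha> \<in> hat A ` carrier A" using hat_onto[OF assms] by blast
  qed (use hat_clopen in auto)
  ultimately show ?thesis
    unfolding mv_iso_def hat_map_def by simp
qed

section \<open>Inverses of isomorphisms and homeomorphisms\<close>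

lemma mv_iso_inverse:
  assumes h: "h \<in> mv_iso A B"
  shows "restrict (inv_into (carrier A) h) (carrier B) \<in> mv_iso B A"
proof -
  let ?g = "inv_into (carrier A) h"
  have bij: "bij_betw h (carrier A) (carrier B)" and hom: "h \<in> mv_hom A B"
    using h by (auto simp: mv_iso_def)
  have inv: "?g (h x) = x" if "x \<in> carrier A" for x using bij_betw_inv_into_left[OF bij that] .
  have ex: "\<exists>x\<in>carrier A. y = h x" if "y \<in> carrier B" for y
    using bij that by (auto simp: bij_betw_def)
  have hB: "h x \<in> carrier B" if "x \<in> carrier A" for x using bij that by (auto simp: bij_betw_def)
  have hom': "h x \<oplus>\<^bsub>B\<^esub> h y = h (x \<oplus> y)" "\<sim>\<^bsub>B\<^esub> h x = h (\<sim> x)" "\<zero>\<^bsub>B\<^esub> = h \<zero>"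
    if "x \<in> carrier A" "y \<in> carrier A" for x y
    using hom that by (auto simp: mv_hom_def)
  have "restrict ?g (carrier B) \<in> mv_hom B A"
    unfolding mv_hom_def
  proof (intro CollectI conjI ballI)
    show "restrict ?g (carrier B) \<in> carrier B \<rightarrow>\<^sub>E carrier A"
      using bij_betw_apply[OF bij_betw_inv_into[OF bij]] by auto
  next
    fix y z assume yz: "y \<in> carrier B" "z \<in> carrier B"
    obtain u where "u \<in> carrier A" "y = h u" using ex[OF yz(1)] by (rule bexE)
    moreover obtain v where "v \<in> carrier A" "z = h v" using ex[OF yz(2)] by (rule bexE)
    ultimately show "restrict ?g (carrier B) (y \<oplus>\<^bsub>B\<^esub> z) =
        restrict ?g (carrier B) y \<oplus> restrict ?g (carrier B) z"
      by (simp add: hom' hB inv)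
  next
    fix y assume y: "y \<in> carrier B"
    obtain u where "u \<in> carrier A" "y = h u" using ex[OF y] by (rule bexE)
    then show "restrict ?g (carrier B) (\<sim>\<^bsub>B\<^esub> y) = \<sim> (restrict ?g (carrier B) y)"
      by (simp add: hom'(2)[of u u] hB inv)
  next
    show "restrict ?g (carrier B) \<zero>\<^bsub>B\<^esub> = \<zero>"
      by (simp add: hom'(3)[of \<zero> \<zero>] hB inv)
  qed
  moreover have "bij_betw (restrict ?g (carrier B)) (carrier B) (carrier A)"
    using bij_betw_inv_into[OF bij] by simp
  ultimately show ?thesis by (simp add: mv_iso_def)
qed

end

lemma mv_homeo_inverse:
  assumes f: "f \<in> mv_homeo S T"
  shows "restrict (inv_into (carrier S) f) (carrier T) \<in> mv_homeo T S"
proof -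
  let ?g = "restrict (inv_into (carrier S) f) (carrier T)"
  have bij: "bij_betw f (carrier S) (carrier T)" and cf: "f \<in> mv_continuous S T"
    and cg: "?g \<in> mv_continuous T S" using f by (auto simp: mv_homeo_def)
  have bij': "bij_betw ?g (carrier T) (carrier S)"
    using bij_betw_inv_into[OF bij] by simp
  \<comment> \<open>The inverse of the inverse is f itself as an extensional function, so its
    continuity is that of f.\<close>
  have "restrict (inv_into (carrier T) ?g) (carrier S) = f"
  proof (rule extensionalityI)
    show "f \<in> extensional (carrier S)" using cf by (auto simp: mv_continuous_def PiE_def)
    fix x assume x: "x \<in> carrier S"
    have "f x \<in> carrier T" using bij x by (auto simp: bij_betw_def)
    moreover have "?g (f x) = x"
      using bij_betw_inv_into_left[OF bij x] calculation by simp
    ultimately have "inv_into (carrier T) ?g x = f x"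
      using bij_betw_inv_into_left[OF bij', of "f x"] by simp
    then show "restrict (inv_into (carrier T) ?g) (carrier S) x = f x" using x by simp
  qed simp
  then show ?thesis using bij' cf cg by (simp add: mv_homeo_def)
qed

section \<open>Continuous maps and functoriality of Clop\<close>

lemma mv_continuous_id:
  assumes "stone_mv_space S"
  shows "(\<lambda>x\<in>carrier S. x) \<in> mv_continuous S S"
proof -
  have "compose (carrier S) \<alpha> (\<lambda>x\<in>carrier S. x) = \<alpha>" if "\<alpha> \<in> opens S" for \<alpha>
    using that stone_space.opens_closed[OF stone_space.intro[OF assms]]
    by (auto simp: compose_def fun_eq_iff fuzzy_carrier_iff extensional_def subset_iff)
  then show ?thesis by (simp add: mv_continuous_def)
qed

lemma mv_continuous_compose:
  assumes "f \<in> mv_continuous S T" "g \<in> mv_continuous T U"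
  shows "compose (carrier S) g f \<in> mv_continuous S U"
proof -
  have f: "f \<in> carrier S \<rightarrow>\<^sub>E carrier T" and g: "g \<in> carrier T \<rightarrow>\<^sub>E carrier U"
    using assms by (auto simp: mv_continuous_def)
  then have f': "f \<in> carrier S \<rightarrow> carrier T" by auto
  have "compose (carrier S) \<alpha> (compose (carrier S) g f) \<in> opens S" if "\<alpha> \<in> opens U" for \<alpha>
    unfolding compose_assoc[OF f'] using assms that by (simp add: mv_continuous_def)
  moreover have "compose (carrier S) g f \<in> carrier S \<rightarrow>\<^sub>E carrier U"
    using f g by (auto simp: compose_def)
  ultimately show ?thesis by (simp add: mv_continuous_def)
qed

lemma fuzzy_compose:
  assumes "f \<in> X \<rightarrow>\<^sub>E Y"
  shows "compose X (\<alpha> \<oplus>\<^bsub>fuzzy Y\<^esub> \<beta>) f = compose X \<alpha> f \<oplus>\<^bsub>fuzzy X\<^esub> compose X \<beta> f"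
    and "compose X (\<sim>\<^bsub>fuzzy Y\<^esub> \<alpha>) f = \<sim>\<^bsub>fuzzy X\<^esub> compose X \<alpha> f"
    and "compose X \<zero>\<^bsub>fuzzy Y\<^esub> f = \<zero>\<^bsub>fuzzy X\<^esub>"
  using assms by (auto simp: fuzzy_def compose_def fun_eq_iff)

text \<open>Composition with f commutes with complementation, so the openness of \<alpha> and of its
  complement both pull back.\<close>

lemma clopens_compose:
  assumes S: "stone_mv_space S" and T: "stone_mv_space T" and f: "f \<in> mv_continuous S T"
    and \<alpha>: "\<alpha> \<in> clopens T"
  shows "compose (carrier S) \<alpha> f \<in> clopens S"
proof -
  interpret S: stone_space S by unfold_locales fact
  interpret T: stone_space T by unfold_locales fact
  have f': "f \<in> carrier S \<rightarrow>\<^sub>E carrier T" using f by (simp add: mv_continuous_def)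
  show ?thesis
    using f \<alpha> unfolding S.clopens_iff T.clopens_iff fuzzy_compose(2)[OF f', symmetric]
    by (simp add: mv_continuous_def)
qed

lemma Clop_map_hom:
  assumes S: "stone_mv_space S" and T: "stone_mv_space T" and f: "f \<in> mv_continuous S T"
  shows "Clop_map S T f \<in> mv_hom (Clop_algebra T) (Clop_algebra S)"
proof -
  interpret T: stone_space T by unfold_locales fact
  have f': "f \<in> carrier S \<rightarrow>\<^sub>E carrier T" using f by (simp add: mv_continuous_def)
  show ?thesis
    using clopens_compose[OF S T f] T.clopens_plus T.clopens_neg T.clopens_zero
    by (auto simp: mv_hom_def Clop_map_def fuzzy_compose[OF f'])
qed

lemma Clop_map_id:
  assumes "stone_mv_space S"
  shows "Clop_map S S (\<lambda>x\<in>carrier S. x) = (\<lambda>\<alpha>\<in>clopens S. \<alpha>)"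
proof -
  have "compose (carrier S) \<alpha> (\<lambda>x\<in>carrier S. x) = \<alpha>" if "\<alpha> \<in> clopens S" for \<alpha>
    using that stone_space.clopens_closed[OF stone_space.intro[OF assms]]
    by (auto simp: compose_def fun_eq_iff fuzzy_carrier_iff extensional_def subset_iff)
  then show ?thesis by (auto simp: Clop_map_def)
qed

lemma Clop_map_compose:
  assumes "stone_mv_space T" "stone_mv_space U"
    and f: "f \<in> mv_continuous S T" and g: "g \<in> mv_continuous T U"
  shows "Clop_map S U (compose (carrier S) g f) =
    compose (clopens U) (Clop_map S T f) (Clop_map T U g)"
proof -
  have f': "f \<in> carrier S \<rightarrow> carrier T" using f by (auto simp: mv_continuous_def)
  show ?thesis
    using clopens_compose[OF assms(1,2) g] compose_assoc[OF f']
    by (auto simp: Clop_map_def compose_def[of "clopens U"] fun_eq_iff)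
qed

section \<open>Naturality\<close>

lemma hat_map_natural:
  assumes A: "mv_algebra A" and B: "mv_algebra B" and h: "h \<in> mv_hom A B"
  shows "compose (carrier A) (Clop_map (Max_space B) (Max_space A) (Max_map A B h)) (hat_map A) =
    compose (carrier A) (hat_map B) h"
proof (rule ext)
  fix a
  have "h a \<in> carrier B" if "a \<in> carrier A" using h that by (auto simp: mv_hom_def)
  then show "compose (carrier A) (Clop_map (Max_space B) (Max_space A) (Max_map A B h)) (hat_map A) a =
    compose (carrier A) (hat_map B) h a"
    using mv_algebra.hat_clopen[OF A, of a] compose_hat_Max_map[OF A B h, of a]
    by (simp add: compose_def[of "carrier A"] Clop_map_def hat_map_def)
qed

text \<open>The composite of \<alpha> with f vanishes at x iff \<alpha> vanishes at f x, so the
  preimage of the kernel at x is the kernel at f x.\<close>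

lemma point_map_natural:
  assumes S: "stone_mv_space S" and T: "stone_mv_space T" and f: "f \<in> mv_continuous S T"
  shows "compose (carrier S) (Max_map (Clop_algebra T) (Clop_algebra S) (Clop_map S T f)) (point_map S) =
    compose (carrier S) (point_map T) f"
proof (rule ext)
  fix x
  interpret S: stone_space S by unfold_locales fact
  have f': "f x \<in> carrier T" if "x \<in> carrier S" using f that by (auto simp: mv_continuous_def)
  show "compose (carrier S) (Max_map (Clop_algebra T) (Clop_algebra S) (Clop_map S T f)) (point_map S) x =
    compose (carrier S) (point_map T) f x"
  proof (cases "x \<in> carrier S")
    case True
    have "compose (carrier S) \<alpha> f \<in> point_map S x \<longleftrightarrow> \<alpha> (f x) = 0" if "\<alpha> \<in> clopens T" for \<alpha>
      using clopens_compose[OF S T f that] True by (simp add: point_map_def compose_def)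
    then have "{\<alpha> \<in> clopens T. Clop_map S T f \<alpha> \<in> point_map S x} = point_map T (f x)"
      using f'[OF True] by (auto simp: Clop_map_def point_map_def[of T])
    then show ?thesis using True S.point_map_max_ideal[OF True] by (simp add: compose_def Max_map_def)
  qed (simp add: compose_def)
qed

text \<open>The duality is spelled out as two contravariant functors with natural isomorphisms from
  the identities to both composites. Each object has its own type variable, so that morphisms
  between structures over different types are covered.\<close>

theorem theorem4p9:
  shows
    \<comment> \<open>limit cut complete MV-algebras and Stone MV-spaces form categories\<close>
    "(\<forall>A::'a mv_algebra. lcc A \<longrightarrow> (\<lambda>a\<in>carrier A. a) \<in> mv_hom A A) \<and>
     (\<forall>(A::'a mv_algebra) (B::'b mv_algebra) (C::'c mv_algebra). \<forall>h\<in>mv_hom A B. \<forall>k\<in>mv_hom B C.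
        lcc A \<and> lcc B \<and> lcc C \<longrightarrow> compose (carrier A) k h \<in> mv_hom A C) \<and>
     (\<forall>S::'x mv_space. stone_mv_space S \<longrightarrow> (\<lambda>x\<in>carrier S. x) \<in> mv_continuous S S) \<and>
     (\<forall>(S::'x mv_space) (T::'y mv_space) (U::'z mv_space). \<forall>f\<in>mv_continuous S T. \<forall>g\<in>mv_continuous T U.
        stone_mv_space S \<and> stone_mv_space T \<and> stone_mv_space U \<longrightarrow>
        compose (carrier S) g f \<in> mv_continuous S U) \<and>

     \<comment> \<open>Max is a contravariant functor between them\<close>
     (\<forall>A::'a mv_algebra. lcc A \<longrightarrow> stone_mv_space (Max_space A)) \<and>
     (\<forall>(A::'a mv_algebra) (B::'b mv_algebra). \<forall>h\<in>mv_hom A B. lcc A \<and> lcc B \<longrightarrow>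
        Max_map A B h \<in> mv_continuous (Max_space B) (Max_space A)) \<and>
     (\<forall>A::'a mv_algebra. lcc A \<longrightarrow>
        Max_map A A (\<lambda>a\<in>carrier A. a) = (\<lambda>M\<in>carrier (Max_space A). M)) \<and>
     (\<forall>(A::'a mv_algebra) (B::'b mv_algebra) (C::'c mv_algebra). \<forall>h\<in>mv_hom A B. \<forall>k\<in>mv_hom B C.
        lcc A \<and> lcc B \<and> lcc C \<longrightarrow>
        Max_map A C (compose (carrier A) k h) =
          compose (carrier (Max_space C)) (Max_map A B h) (Max_map B C k)) \<and>

     \<comment> \<open>Clop is a contravariant functor in the other direction\<close>
     (\<forall>S::'x mv_space. stone_mv_space S \<longrightarrow> lcc (Clop_algebra S)) \<and>
     (\<forall>(S::'x mv_space) (T::'y mv_space). \<forall>f\<in>mv_continuous S T.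
        stone_mv_space S \<and> stone_mv_space T \<longrightarrow>
        Clop_map S T f \<in> mv_hom (Clop_algebra T) (Clop_algebra S)) \<and>
     (\<forall>S::'x mv_space. stone_mv_space S \<longrightarrow>
        Clop_map S S (\<lambda>x\<in>carrier S. x) = (\<lambda>\<alpha>\<in>carrier (Clop_algebra S). \<alpha>)) \<and>
     (\<forall>(S::'x mv_space) (T::'y mv_space) (U::'z mv_space). \<forall>f\<in>mv_continuous S T. \<forall>g\<in>mv_continuous T U.
        stone_mv_space S \<and> stone_mv_space T \<and> stone_mv_space U \<longrightarrow>
        Clop_map S U (compose (carrier S) g f) =
          compose (carrier (Clop_algebra U)) (Clop_map S T f) (Clop_map T U g)) \<and>

     \<comment> \<open>a natural isomorphism from the identity to Clop Max\<close>
     (\<forall>A::'a mv_algebra. lcc A \<longrightarrow> hat_map A \<in> mv_iso A (Clop_algebra (Max_space A))) \<and>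
     (\<forall>(A::'a mv_algebra) (B::'b mv_algebra). \<forall>h\<in>mv_hom A B. lcc A \<and> lcc B \<longrightarrow>
        compose (carrier A) (Clop_map (Max_space B) (Max_space A) (Max_map A B h)) (hat_map A) =
          compose (carrier A) (hat_map B) h) \<and>

     \<comment> \<open>a natural isomorphism from the identity to Max Clop\<close>
     (\<forall>S::'x mv_space. stone_mv_space S \<longrightarrow>
        point_map S \<in> mv_homeo S (Max_space (Clop_algebra S))) \<and>
     (\<forall>(S::'x mv_space) (T::'y mv_space). \<forall>f\<in>mv_continuous S T.
        stone_mv_space S \<and> stone_mv_space T \<longrightarrow>
        compose (carrier S) (Max_map (Clop_algebra T) (Clop_algebra S) (Clop_map S T f)) (point_map S) =
          compose (carrier S) (point_map T) f) \<and>

     \<comment> \<open>the isomorphisms on objects\<close>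
     (\<forall>A::'a mv_algebra. lcc A \<longrightarrow> mv_iso (Clop_algebra (Max_space A)) A \<noteq> {}) \<and>
     (\<forall>S::'x mv_space. stone_mv_space S \<longrightarrow> mv_homeo (Max_space (Clop_algebra S)) S \<noteq> {})"
proof (intro conjI allI ballI impI; (elim conjE)?)
  fix A :: "'a mv_algebra" assume A: "lcc A"
  interpret mv_algebra A by (rule lcc_mv_algebra[OF A])
  show "(\<lambda>a\<in>carrier A. a) \<in> mv_hom A A" by (auto simp: mv_hom_def)
  show "stone_mv_space (Max_space A)" by (rule stone_Max)
  show "Max_map A A (\<lambda>a\<in>carrier A. a) = (\<lambda>M\<in>carrier (Max_space A). M)"
    using Max_map_id[OF mv_algebra_axioms] by simp
  show "hat_map A \<in> mv_iso A (Clop_algebra (Max_space A))" by (rule hat_map_iso[OF A])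
  from mv_iso_inverse[OF this] show "mv_iso (Clop_algebra (Max_space A)) A \<noteq> {}" by blast
next
  fix A :: "'a mv_algebra" and B :: "'b mv_algebra" and h
  assume h: "h \<in> mv_hom A B" and "lcc A" "lcc B"
  then have A: "mv_algebra A" and B: "mv_algebra B" by (simp_all add: lcc_mv_algebra)
  show "Max_map A B h \<in> mv_continuous (Max_space B) (Max_space A)"
    by (rule Max_map_continuous[OF A B h])
  show "compose (carrier A) (Clop_map (Max_space B) (Max_space A) (Max_map A B h)) (hat_map A) =
      compose (carrier A) (hat_map B) h"
    by (rule hat_map_natural[OF A B h])
next
  fix A :: "'a mv_algebra" and B :: "'b mv_algebra" and C :: "'c mv_algebra" and h k
  assume h: "h \<in> mv_hom A B" and k: "k \<in> mv_hom B C" and "lcc A" "lcc B" "lcc C"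
  then have A: "mv_algebra A" and B: "mv_algebra B" and C: "mv_algebra C"
    by (simp_all add: lcc_mv_algebra)
  show "compose (carrier A) k h \<in> mv_hom A C" by (rule mv_hom_compose[OF A h k])
  show "Max_map A C (compose (carrier A) k h) =
      compose (carrier (Max_space C)) (Max_map A B h) (Max_map B C k)"
    using Max_map_compose[OF A B C h k] by simp
next
  fix S :: "'x mv_space" assume S: "stone_mv_space S"
  interpret stone_space S by unfold_locales (rule S)
  show "(\<lambda>x\<in>carrier S. x) \<in> mv_continuous S S" by (rule mv_continuous_id[OF S])
  show "lcc (Clop_algebra S)" by (rule lcc_Clop)
  show "Clop_map S S (\<lambda>x\<in>carrier S. x) = (\<lambda>\<alpha>\<in>carrier (Clop_algebra S). \<alpha>)"
    using Clop_map_id[OF S] by simp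
  show "point_map S \<in> mv_homeo S (Max_space (Clop_algebra S))" by (rule homeo_point_map)
  from mv_homeo_inverse[OF this] show "mv_homeo (Max_space (Clop_algebra S)) S \<noteq> {}" by blast
next
  fix S :: "'x mv_space" and T :: "'y mv_space" and f
  assume f: "f \<in> mv_continuous S T" and ST: "stone_mv_space S" "stone_mv_space T"
  show "Clop_map S T f \<in> mv_hom (Clop_algebra T) (Clop_algebra S)" by (rule Clop_map_hom[OF ST f])
  show "compose (carrier S) (Max_map (Clop_algebra T) (Clop_algebra S) (Clop_map S T f)) (point_map S) =
      compose (carrier S) (point_map T) f"
    by (rule point_map_natural[OF ST f])
next
  fix S :: "'x mv_space" and T :: "'y mv_space" and U :: "'z mv_space" and f g
  assume f: "f \<in> mv_continuous S T" and g: "g \<in> mv_continuous T U"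
    and "stone_mv_space S" and TU: "stone_mv_space T" "stone_mv_space U"
  show "compose (carrier S) g f \<in> mv_continuous S U" by (rule mv_continuous_compose[OF f g])
  show "Clop_map S U (compose (carrier S) g f) =
      compose (carrier (Clop_algebra U)) (Clop_map S T f) (Clop_map T U g)"
    using Clop_map_compose[OF TU f g] by simp
qed

end
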